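(* Let $p\in(0,1]$ be a constant. Consider $n$ nodes and $k$ tokens, and suppose that initially each of the $n$ nodes holds each of the $k$ tokens independently with probability $p$. Then, in the weakly adaptive adversary model, the SYM-DIFF protocol completes $k$-gossip in $O((n+k)\log n\log k)$ rounds with high probability, where the implied constant depends only on $p$ and the probability is over both the initial assignment of tokens and the randomness of the protocol.
   Context: $k$-gossip: there are $n$ nodes and $k$ distinct tokens; initially each node holds some subset of the tokens, and the goal is that every node holds all $k$ tokens. Communication proceeds in synchronous rounds; a node never loses a token it holds. Weakly adaptive adversary model: in each round the adversary, knowing the token distribution at the start of the round (i.e. the entire history so far, but not the random choices of the current or future rounds), first lays down an arbitrary connected communication graph on the $n$ nodes; this graph is then known to the nodes, and each node can send a possibly distinct token to each of its neighbors. SYM-DIFF protocol: in each round, independently along every edge $(u,v)$ of the communication graph, a token $t$ is sampled uniformly at random from the symmetric difference of the sets of tokens held by $u$ and by $v$ at the start of the round, and the node among $u,v$ that holds $t$ sends it to the other node (nothing is sent if the symmetric difference is empty). "With high probability" means with probability at least $1-n^{-a}$ for some constant $a>0$. The bound is asymptotic, with $n,k\ge 2$.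
   Formalization: Completion of k-gossip is claimed when w.h.p. every token is initially held by some node (for p<1 and k exponentially large in n this can fail, making the claim false); without that condition, it is shown that w.h.p. all initially held tokens reach all nodes. *)

theory Defs
  imports "HOL-Probability.Probability"
begin

text \<open>Nodes are the numbers below \<open>n\<close>, tokens the numbers below \<open>k\<close>; a configuration maps each
  node to the set of tokens it holds.\<close>

type_synonym config = "nat \<Rightarrow> nat set"

text \<open>An undirected simple graph is given by its set of edges, the edge joining \<open>u < v\<close> being
  represented once, as the pair \<open>(u, v)\<close>.\<close>

type_synonym edge = "nat \<times> nat"

definition connected_graph :: "nat \<Rightarrow> edge set \<Rightarrow> bool" where
  "connected_graph n E \<longleftrightarrow>
     E \<subseteq> {(u, v). u < v \<and> v < n} \<and> (\<forall>u<n. \<forall>v<n. (u, v) \<in> (E \<union> E\<inverse>)\<^sup>*)"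

definition random_config :: "nat \<Rightarrow> nat \<Rightarrow> real \<Rightarrow> config pmf" where
  "random_config n k p =
     map_pmf (\<lambda>b u. {t. b (u, t)}) (Pi_pmf ({..<n} \<times> {..<k}) False (\<lambda>_. bernoulli_pmf p))"

text \<open>The token travelling along each edge in a round; \<open>None\<close> if nothing is sent.\<close>

type_synonym transfer = "edge \<Rightarrow> nat option"

definition sample_token :: "config \<Rightarrow> edge \<Rightarrow> nat option pmf" where
  "sample_token S e =
     (let D = sym_diff (S (fst e)) (S (snd e)) in
      if D = {} then return_pmf None else map_pmf Some (pmf_of_set D))"

definition sample_transfer :: "config \<Rightarrow> edge set \<Rightarrow> transfer pmf" where
  "sample_transfer S E = Pi_pmf E None (sample_token S)"

definition deliver :: "config \<Rightarrow> edge set \<Rightarrow> transfer \<Rightarrow> config" where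
  "deliver S E c = (\<lambda>w. S w \<union>
     {t. \<exists>v. ((v, w) \<in> E \<and> c (v, w) = Some t \<or> (w, v) \<in> E \<and> c (w, v) = Some t) \<and> t \<in> S v})"

text \<open>The past rounds, latest first: starting configuration, graph and transfers of each round.\<close>

type_synonym history = "(config \<times> edge set \<times> transfer) list"

text \<open>A weakly adaptive adversary picks the graph of a round from everything that happened
  before it and from the configuration at its start, but before the transfers are sampled.\<close>

type_synonym adversary = "history \<Rightarrow> config \<Rightarrow> edge set"

definition valid_adversary :: "nat \<Rightarrow> adversary \<Rightarrow> bool" where
  "valid_adversary n adv \<longleftrightarrow> (\<forall>h S. connected_graph n (adv h S))"

primrec sym_diff_exec :: "adversary \<Rightarrow> config \<Rightarrow> nat \<Rightarrow> (history \<times> config) pmf" where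
  "sym_diff_exec adv S0 0 = return_pmf ([], S0)"
| "sym_diff_exec adv S0 (Suc T) =
     bind_pmf (sym_diff_exec adv S0 T) (\<lambda>(h, S).
       let E = adv h S in
       map_pmf (\<lambda>c. ((S, E, c) # h, deliver S E c)) (sample_transfer S E))"

text \<open>Joint law of the initial configuration and the configuration after \<open>T\<close> rounds.\<close>

definition sym_diff_run ::
  "nat \<Rightarrow> nat \<Rightarrow> real \<Rightarrow> adversary \<Rightarrow> nat \<Rightarrow> (config \<times> config) pmf" where
  "sym_diff_run n k p adv T =
     bind_pmf (random_config n k p) (\<lambda>S0.
       map_pmf (\<lambda>(h, S). (S0, S)) (sym_diff_exec adv S0 T))"

definition gossip_complete :: "nat \<Rightarrow> nat \<Rightarrow> config \<Rightarrow> bool" where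
  "gossip_complete n k S \<longleftrightarrow> (\<forall>u<n. \<forall>t<k. t \<in> S u)"

text \<open>Tokens are never created, so gossip on \<open>k\<close> tokens can be completed only from a configuration
  in which each of them is held by some node. A random configuration can violate this: a given
  token is absent with probability \<open>(1 - p) ^ n\<close>, so if \<open>k\<close> is exponentially large in \<open>n\<close>, some
  token is likely to be absent.\<close>

definition tokens_present :: "nat \<Rightarrow> nat \<Rightarrow> config \<Rightarrow> bool" where
  "tokens_present n k S \<longleftrightarrow> (\<forall>t<k. \<exists>u<n. t \<in> S u)"

definition all_disseminated :: "nat \<Rightarrow> config \<Rightarrow> config \<Rightarrow> bool" where
  "all_disseminated n S0 S \<longleftrightarrow> (\<forall>u<n. \<forall>v<n. S0 v \<subseteq> S u)"

end

theory Submission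
  imports Defs
begin

text \<open>
  Let \<open>P\<close> be the set of tokens held by somebody and \<open>x\<^sub>u = |P - S u|\<close>. Initially, with probability at
  least \<open>1 - 1/(2n)\<close>, no \<open>g = \<Theta>(log (n k))\<close> nodes lack \<open>g\<close> common tokens, and this persists, since
  tokens are never lost. Fix \<open>h \<ge> 16 g\<close>, let \<open>U\<close> be the set of nodes with \<open>x\<^sub>u \<ge> h\<close>, and call an edge
  inside \<open>U\<close> close if its symmetric difference has size at most \<open>h/(4g)\<close>. A connected set of \<open>g\<close>
  nodes joined by close edges would lack \<open>3h/4\<close> common tokens; so every close component has fewer
  than \<open>g\<close> nodes and is left by an edge of the graph. Along such an edge the endpoint
  lacking more tokens learns something with probability at least \<open>1/2\<close>; it belongs to \<open>U\<close>, and a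
  bound on coincidences shows that \<open>U\<close> learns \<open>\<Omega>(min |U| h / g)\<close> tokens per round in expectation.

  A potential \<open>\<Sum>\<^sub>u \<Sum>\<^bsub>h \<le> x\<^sub>u\<^esub> w\<^sub>h\<close> whose weights grow like \<open>w' / w \<ge> \<Omega>(g max 1 (n/h) / (n + k))\<close>
  turns these bounds for all \<open>h\<close> at once, by Abel summation, into a multiplicative drift
  \<open>1 - \<Omega>(1/(n + k))\<close>. After \<open>O((n + k) log n log k)\<close> rounds every node lacks \<open>O(g)\<close> tokens; from
  then on at least one token is learned per round, which takes \<open>O(n g)\<close> further rounds.
\<close>

section \<open>Edges leaving the components of nearly equal nodes\<close>

text \<open>Here \<open>X u\<close> will be the set of tokens that \<open>u\<close> lacks. The
  receiver is the endpoint lacking at least as many, so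
  \<open>X (receiver X e) - X (sender X e)\<close> consists of tokens that the sender can pass to
  it.\<close>

definition receiver :: "(nat \<Rightarrow> 'a set) \<Rightarrow> edge \<Rightarrow> nat" where
  "receiver X e = (if card (X (snd e)) \<le> card (X (fst e)) then fst e else snd e)"

definition sender :: "(nat \<Rightarrow> 'a set) \<Rightarrow> edge \<Rightarrow> nat" where
  "sender X e = (if card (X (snd e)) \<le> card (X (fst e)) then snd e else fst e)"

text \<open>Of the two one-sided differences, the one taken from the larger set is the larger. Hence
  a uniform sample from the symmetric difference travels towards the receiver with probability at
  least 1/2.\<close>

lemma card_sym_diff_le_receiver:
  assumes "finite (X (fst e))" "finite (X (snd e))"
  shows "card (sym_diff (X (fst e)) (X (snd e))) \<le> 2 * card (X (receiver X e) - X (sender X e))"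
proof -
  let ?A = "X (fst e)" and ?B = "X (snd e)"
  have a: "card ?A = card (?A - ?B) + card (?A \<inter> ?B)"
    by (metis assms(1) card_Diff_subset_Int card_mono finite_Int inf_le1 le_add_diff_inverse2)
  have b: "card ?B = card (?B - ?A) + card (?A \<inter> ?B)"
    by (metis assms(2) card_Diff_subset_Int card_mono finite_Int inf_le1 inf_commute le_add_diff_inverse2)
  have "card (sym_diff ?A ?B) \<le> card (?A - ?B) + card (?B - ?A)" by (rule card_Un_le)
  then show ?thesis using a b unfolding receiver_def sender_def by (auto split: if_splits)
qed

lemma crossing_edge:
  assumes "connected_graph n E" "C \<subseteq> {..<n}" "a \<in> C" "b < n" "b \<notin> C"
  obtains u v where "u \<in> C" "v \<notin> C" "u < n" "v < n" "(u, v) \<in> E \<union> E\<inverse>"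
proof -
  have Esub: "E \<subseteq> {(u, v). u < v \<and> v < n}" and "(a, b) \<in> (E \<union> E\<inverse>)\<^sup>*"
    using assms unfolding connected_graph_def by auto
  from this(2) have "\<exists>u v. u \<in> C \<and> v \<notin> C \<and> (u, v) \<in> E \<union> E\<inverse>"
    using \<open>b \<notin> C\<close>
  proof (induction rule: rtrancl_induct)
    case base then show ?case using assms by auto
  next
    case (step y z) then show ?case by (cases "y \<in> C") auto
  qed
  then show thesis using that Esub by fastforce
qed

text \<open>Grow a set \<open>W\<close> inside the component from \<open>u\<close>, each new node
  \<open>z\<close> being joined by a close edge to some \<open>y\<close> already in
  \<open>W\<close>. A token common to \<open>W\<close> but not in \<open>X z\<close> lies in the
  symmetric difference of \<open>X y\<close> and \<open>X z\<close>, so each step costs at most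
  \<open>h / (4 * g)\<close> tokens. After \<open>g - 1\<close> steps fewer than
  \<open>h / 4\<close> of the at least \<open>h\<close> tokens of \<open>X u\<close> are lost, which
  leaves more than \<open>3 * h / 4 \<ge> 12 * g\<close> common ones, against
  \<open>good\<close>.\<close>

lemma close_component_small:
  fixes X :: "nat \<Rightarrow> 'a set"
  assumes fin: "finite U" "\<And>u. u \<in> U \<Longrightarrow> finite (X u)" and u: "u \<in> U"
    and large: "\<And>u. u \<in> U \<Longrightarrow> h \<le> card (X u)"
    and good: "\<And>W. W \<subseteq> U \<Longrightarrow> card W = g \<Longrightarrow> card (\<Inter>w\<in>W. X w) < g"
    and g: "0 < g" "16 * g \<le> h"
    and R: "R \<subseteq> {(a, b). a \<in> U \<and> b \<in> U \<and> 4 * g * card (sym_diff (X a) (X b)) \<le> h}"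
  shows "card (R\<^sup>* `` {u}) < g"
proof (rule ccontr)
  define C where "C = R\<^sup>* `` {u}"
  assume "\<not> card (R\<^sup>* `` {u}) < g"
  then have big: "g \<le> card C" by (simp add: C_def)
  have CU: "C \<subseteq> U"
  proof
    fix v assume "v \<in> C"
    then have "(u, v) \<in> R\<^sup>*" by (simp add: C_def)
    then show "v \<in> U" using u R by (induction rule: rtrancl_induct) auto
  qed
  have finC: "finite C" using CU fin finite_subset by blast
  have "\<exists>W\<subseteq>C. u \<in> W \<and> card W = Suc j \<and> 4 * g * card (X u - (\<Inter>w\<in>W. X w)) \<le> j * h"
    if "Suc j \<le> g" for j
    using that
  proof (induction j)
    case 0
    show ?case by (intro exI[of _ "{u}"]) (auto simp: C_def)
  next
    case (Suc j)
    then obtain W where W: "W \<subseteq> C" "u \<in> W" "card W = Suc j"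
      "4 * g * card (X u - (\<Inter>w\<in>W. X w)) \<le> j * h" by auto
    have "W \<noteq> C" using W(3) Suc.prems big by auto
    then obtain b where b: "b \<in> C" "b \<notin> W" using W by blast
    then have "(u, b) \<in> R\<^sup>*" by (simp add: C_def)
    from this b(2) have "\<exists>y z. y \<in> W \<and> z \<notin> W \<and> (y, z) \<in> R \<and> z \<in> C"
    proof (induction rule: rtrancl_induct)
      case base then show ?case using W by auto
    next
      case (step y z)
      then have "z \<in> C" unfolding C_def by auto
      then show ?case using step by (cases "y \<in> W") auto
    qed
    then obtain y z where yz: "y \<in> W" "z \<notin> W" "(y, z) \<in> R" "z \<in> C" by auto
    have fy: "finite (X y)" "finite (X z)" "finite (X u)" using yz W CU fin u by auto
    have "card (X u - (\<Inter>w\<in>insert z W. X w)) \<le>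
        card ((X u - (\<Inter>w\<in>W. X w)) \<union> sym_diff (X y) (X z))"
      using fy yz(1) by (intro card_mono) auto
    also have "\<dots> \<le> card (X u - (\<Inter>w\<in>W. X w)) + card (sym_diff (X y) (X z))"
      by (rule card_Un_le)
    finally have "4 * g * card (X u - (\<Inter>w\<in>insert z W. X w)) \<le>
        4 * g * card (X u - (\<Inter>w\<in>W. X w)) + 4 * g * card (sym_diff (X y) (X z))"
      by (metis add_mult_distrib2 mult_le_mono2)
    also have "\<dots> \<le> j * h + h" using W(4) R yz(3) by (intro add_mono) auto
    finally have "4 * g * card (X u - (\<Inter>w\<in>insert z W. X w)) \<le> Suc j * h" by simp
    moreover have "finite W" using W(1) finC finite_subset by blast
    ultimately show ?case using W yz by (intro exI[of _ "insert z W"]) auto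
  qed
  from this[of "g - 1"] g(1) obtain W where W: "W \<subseteq> C" "u \<in> W" "card W = g"
      "4 * g * card (X u - (\<Inter>w\<in>W. X w)) \<le> (g - 1) * h" by auto
  have fu: "finite (X u)" using fin u by auto
  have "card (X u) = card (X u - (\<Inter>w\<in>W. X w)) + card (\<Inter>w\<in>W. X w)"
  proof -
    have "(\<Inter>w\<in>W. X w) \<subseteq> X u" using W by auto
    then show ?thesis using fu
      by (metis card_Diff_subset card_mono finite_subset le_add_diff_inverse2)
  qed
  then have "4 * g * card (X u) \<le> (g - 1) * h + 4 * g * card (\<Inter>w\<in>W. X w)"
    using W(4) by (simp add: algebra_simps)
  also have "\<dots> \<le> (g - 1) * h + 4 * g * g"
  proof -
    have "W \<subseteq> U" using W CU by auto
    then have "card (\<Inter>w\<in>W. X w) \<le> g" using good W(3) by (simp add: less_imp_le)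
    then show ?thesis by simp
  qed
  finally have "4 * g * h \<le> (g - 1) * h + 4 * g * g"
    using large[OF u] by (meson le_trans mult_le_mono2)
  then have "4 * (g * h) \<le> (g - 1) * h + 4 * (g * g)" by (simp only: mult.assoc)
  moreover have "(g - 1) * h \<le> g * h" by simp
  moreover have "16 * (g * g) \<le> g * h" using mult_le_mono2[OF g(2), of g] by (simp only: mult_ac)
  moreover have "0 < g * h" using g by simp
  ultimately show False by linarith
qed

text \<open>Selects the edges on which progress is counted. The coincidence bound ensures that the
  other selected edges spoil at most half of the new tokens of an edge; the last bound limits what
  one node is credited with, so that its weights stay comparable. There are at least
  \<open>card U / g\<close> components, and at least half of them agree on whether their chosen edge
  stays inside \<open>U\<close> or leaves it.\<close>

lemma receiving_edges:
  fixes X :: "nat \<Rightarrow> 'a set"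
  assumes conn: "connected_graph n E" and fin: "\<And>u. u < n \<Longrightarrow> finite (X u)"
    and good: "\<And>W. W \<subseteq> {..<n} \<Longrightarrow> card W = g \<Longrightarrow> card (\<Inter>w\<in>W. X w) < g"
    and g: "0 < g" "g \<le> n" "16 * g \<le> h"
    and U: "U = {u. u < n \<and> h \<le> card (X u)}" "U \<noteq> {}"
  obtains F where "F \<subseteq> E" "real (min (card U) h) \<le> 32 * g * card F"
    "\<And>e. e \<in> F \<Longrightarrow> receiver X e \<in> U"
    "\<And>e. e \<in> F \<Longrightarrow> X (receiver X e) - X (sender X e) \<noteq> {}"
    "\<And>e. e \<in> F \<Longrightarrow> 2 * card {e' \<in> F - {e}. receiver X e' = receiver X e}
        \<le> card (X (receiver X e) - X (sender X e))"
    "\<And>u. card {e \<in> F. receiver X e = u} \<le> h div (16 * g)"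
proof -
  define R where "R = {(a, b). a \<in> U \<and> b \<in> U \<and> (a, b) \<in> E \<union> E\<inverse> \<and>
    4 * g * card (sym_diff (X a) (X b)) \<le> h}"
  define comp where "comp u = R\<^sup>* `` {u}" for u
  \<comment> \<open>A far edge between different components has more than \<open>h / (8 * g)\<close>
    new tokens for its receiver, hence at least \<open>2 * m\<close>; rounding down loses at most a
    factor 2 because \<open>m \<ge> 1\<close>.\<close>
  define m where "m = h div (16 * g)"
  have m1: "1 \<le> m" using g by (simp add: m_def Suc_le_eq div_greater_zero_iff)
  have hm: "h \<le> 32 * g * m"
  proof -
    have "h = 16 * g * m + h mod (16 * g)" by (simp add: m_def)
    moreover have "h mod (16 * g) < 16 * g" using g by simp
    moreover have "16 * g * 1 \<le> 16 * g * m" using m1 by (intro mult_le_mono2)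
    ultimately show ?thesis by linarith
  qed
  have Esub: "E \<subseteq> {(u, v). u < v \<and> v < n}" using conn by (auto simp: connected_graph_def)
  have finE: "finite E"
    by (rule finite_subset[OF Esub], rule finite_subset[of _ "{..<n} \<times> {..<n}"]) auto
  have finU: "finite U" using U by auto
  have symR: "sym R" unfolding R_def sym_def by (auto simp: Un_commute)
  have comp_sub: "comp u \<subseteq> U" if "u \<in> U" for u
  proof
    fix v assume "v \<in> comp u"
    then have "(u, v) \<in> R\<^sup>*" by (simp add: comp_def)
    then show "v \<in> U" using that by (induction rule: rtrancl_induct) (auto simp: R_def)
  qed
  have comp_eq: "comp v = comp u" if "v \<in> comp u" for u v
  proof -
    have "(u, v) \<in> R\<^sup>*" "(v, u) \<in> R\<^sup>*"
      using that symD[OF sym_rtrancl[OF symR]] by (auto simp: comp_def)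
    then show ?thesis unfolding comp_def by (auto intro: rtrancl_trans)
  qed
  have comp_self: "u \<in> comp u" for u by (simp add: comp_def)
  have comp_small: "card (comp u) < g" if "u \<in> U" for u
    unfolding comp_def
  proof (rule close_component_small[where U = U and X = X and h = h])
    show "card (\<Inter>w\<in>W. X w) < g" if "W \<subseteq> U" "card W = g" for W
      using that U(1) by (intro good) auto
  qed (use that fin U g in \<open>auto simp: R_def\<close>)
  define CC where "CC = comp ` U"
  have finCC: "finite CC" using finU by (simp add: CC_def)
  have U_le: "card U \<le> card CC * g"
  proof -
    have "U \<subseteq> \<Union>CC" using comp_self by (auto simp: CC_def)
    then have "card U \<le> card (\<Union>CC)"
      using finU comp_sub by (intro card_mono) (auto simp: CC_def intro: finite_subset)
    also have "\<dots> \<le> (\<Sum>C\<in>CC. card C)" by (rule card_Union_le_sum_card)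
    also have "\<dots> \<le> (\<Sum>C\<in>CC. g)" using comp_small by (intro sum_mono) (auto simp: CC_def less_imp_le)
    finally show ?thesis by simp
  qed
  define leave where "leave C e \<longleftrightarrow> e \<in> E \<and> (\<exists>a b. a \<in> C \<and> b \<notin> C \<and> b < n \<and> (e = (a, b) \<or> e = (b, a)))" for C e
  have ex_leave: "\<exists>e. leave C e" if "C \<in> CC" for C
  proof -
    obtain u where u: "u \<in> U" "C = comp u" using \<open>C \<in> CC\<close> by (auto simp: CC_def)
    have "C \<subseteq> {..<n}" using comp_sub[OF u(1)] u U(1) by auto
    moreover have "card C < card {..<n}" using comp_small[OF u(1)] u g by simp
    ultimately obtain b where "b < n" "b \<notin> C" by (metis lessThan_iff nat_neq_iff subsetI subset_antisym)
    with crossing_edge[OF conn \<open>C \<subseteq> {..<n}\<close>, of u b] comp_self u(2)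
    obtain a b where "a \<in> C" "b \<notin> C" "b < n" "(a, b) \<in> E \<union> E\<inverse>" by metis
    then show ?thesis unfolding leave_def by blast
  qed
  define eps where "eps C = (SOME e. leave C e)" for C
  have eps: "leave C (eps C)" if "C \<in> CC" for C
    unfolding eps_def using ex_leave[OF that] by (rule someI_ex)
  define far where "far e \<longleftrightarrow> fst e \<in> U \<and> snd e \<in> U" for e :: edge
  \<comment> \<open>An edge may be chosen by two components in \<open>C1\<close>, but is then far, so one receiver may use several;
    edges chosen in \<open>C2\<close> go down to a node outside \<open>U\<close>, possibly with a single new token each, but
    their receivers lie in distinct components.\<close>
  define C1 where "C1 = {C \<in> CC. far (eps C)}"
  define C2 where "C2 = {C \<in> CC. \<not> far (eps C)}"
  have CC_split: "card CC = card C1 + card C2"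
  proof -
    have "CC = C1 \<union> C2" "C1 \<inter> C2 = {}" by (auto simp: C1_def C2_def)
    then show ?thesis using finCC by (metis card_Un_disjoint finite_Un)
  qed
  have finX: "finite (X (fst e))" "finite (X (snd e))" if "e \<in> E" for e
    using that Esub by (auto intro!: fin)
  show thesis
  proof (cases "card C2 \<le> card C1")
    case True
    define F0 where "F0 = eps ` C1"
    have finF0: "finite F0" using finCC by (simp add: F0_def C1_def)
    \<comment> \<open>Each component is recovered from one of the two endpoints of its edge, so no
      edge is chosen by more than two components.\<close>
    have "C1 \<subseteq> (\<lambda>e. comp (fst e)) ` F0 \<union> (\<lambda>e. comp (snd e)) ` F0"
    proof
      fix C assume C: "C \<in> C1"
      then have "C \<in> CC" by (simp add: C1_def)
      from eps[OF this] obtain a b where ab: "a \<in> C" "eps C = (a, b) \<or> eps C = (b, a)"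
        by (auto simp: leave_def)
      have "C = comp a" using \<open>C \<in> CC\<close> ab(1) comp_eq unfolding CC_def by blast
      then have "C = comp (fst (eps C)) \<or> C = comp (snd (eps C))"
        using ab(2) by (metis fst_conv snd_conv)
      moreover have "eps C \<in> F0" using C by (simp add: F0_def)
      ultimately show "C \<in> (\<lambda>e. comp (fst e)) ` F0 \<union> (\<lambda>e. comp (snd e)) ` F0"
        by blast
    qed
    then have "card C1 \<le> card F0 + card F0"
      by (meson add_mono card_Un_le card_image_le card_mono finF0 finite_Un finite_imageI le_trans)
    then have CF: "card CC \<le> 4 * card F0" using True CC_split by simp
    \<comment> \<open>Keeping at most \<open>m\<close> edges makes the coincidence bound hold even
      if they all share one receiver, as each has at least \<open>2 * m\<close> new tokens. The
      truncation is paid for by the minimum with \<open>h\<close> in the claim, since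
      \<open>h \<le> 32 * g * m\<close>.\<close>
    obtain F where F: "F \<subseteq> F0" "card F = min (card F0) m"
      by (meson min.cobounded1 obtain_subset_with_card_n)
    have finF: "finite F" using F finF0 finite_subset by blast
    have far: "e \<in> E" "fst e \<in> U" "snd e \<in> U" "h < 4 * g * card (sym_diff (X (fst e)) (X (snd e)))"
      if "e \<in> F" for e
    proof -
      obtain C where C: "C \<in> C1" "e = eps C" using \<open>e \<in> F\<close> F by (auto simp: F0_def)
      then have CCC: "C \<in> CC" and "far e" by (auto simp: C1_def)
      from eps[OF CCC] C(2) have lv: "leave C e" by simp
      then show "e \<in> E" "fst e \<in> U" "snd e \<in> U" using \<open>far e\<close> by (auto simp: leave_def far_def)
      from lv obtain a b where ab: "a \<in> C" "b \<notin> C" "e = (a, b) \<or> e = (b, a)" "e \<in> E"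
        by (auto simp: leave_def)
      have "C = comp a" using CCC ab(1) comp_eq unfolding CC_def by blast
      \<comment> \<open>Both ends lie in \<open>U\<close> and the pair is an edge, so only closeness
        can fail for it.\<close>
      then have "(a, b) \<notin> R" using ab(2) by (auto simp: comp_def)
      moreover have "a \<in> U" "b \<in> U" "(a, b) \<in> E \<union> E\<inverse>" using ab \<open>far e\<close> by (auto simp: far_def)
      ultimately have "h < 4 * g * card (sym_diff (X a) (X b))" by (auto simp: R_def)
      then show "h < 4 * g * card (sym_diff (X (fst e)) (X (snd e)))"
        using ab(3) by (auto simp: Un_commute)
    qed
    have A: "2 * m \<le> card (X (receiver X e) - X (sender X e))" if "e \<in> F" for e
    proof -
      have "h < 4 * g * (2 * card (X (receiver X e) - X (sender X e)))"
        using card_sym_diff_le_receiver[of X e] far[OF that] finX[of e]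
        by (meson less_le_trans mult_le_mono2)
      moreover have "16 * g * m \<le> h" by (simp add: m_def)
      ultimately have "8 * g * (2 * m) < 8 * g * card (X (receiver X e) - X (sender X e))"
        by linarith
      then show ?thesis using g by simp
    qed
    have Fm: "card F \<le> m" using F by simp
    have "real (min (card U) h) \<le> 32 * g * card F"
    proof -
      have "card U \<le> 4 * card F0 * g" using U_le CF by (meson le_trans mult_le_mono1)
      then have "card U \<le> 4 * (g * card F0)" by (simp only: mult_ac)
      moreover have "h \<le> 32 * (g * m)" using hm by (simp only: mult_ac)
      ultimately have "min (card U) h \<le> 32 * (g * card F)"
        by (cases "card F0 \<le> m") (simp_all add: F(2))
      then have "min (card U) h \<le> 32 * g * card F" by (simp only: mult_ac)
      then show ?thesis using of_nat_mono[of "min (card U) h" "32 * g * card F"] by simp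
    qed
    moreover have "2 * card {e' \<in> F - {e}. receiver X e' = receiver X e}
        \<le> card (X (receiver X e) - X (sender X e))" if "e \<in> F" for e
    proof -
      have "card {e' \<in> F - {e}. receiver X e' = receiver X e} \<le> card F"
        using finF by (intro card_mono) auto
      then show ?thesis using A[OF that] Fm by simp
    qed
    moreover have "card {e \<in> F. receiver X e = u} \<le> h div (16 * g)" for u
      using card_mono[OF finF, of "{e \<in> F. receiver X e = u}"] Fm unfolding m_def by auto
    moreover have "X (receiver X e) - X (sender X e) \<noteq> {}" if "e \<in> F" for e
      using A[OF that] m1 by (metis card.empty le_zero_eq mult_is_0 not_one_le_zero zero_neq_numeral)
    ultimately show thesis using far by (intro that[of F]) (auto simp: receiver_def)
  next
    case False
    have bd: "receiver X (eps C) \<in> C \<and> eps C \<in> E \<and>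
        card (X (sender X (eps C))) < card (X (receiver X (eps C)))" if "C \<in> C2" for C
    proof -
      have CC: "C \<in> CC" and nf: "\<not> far (eps C)" using that by (auto simp: C2_def)
      from eps[OF CC] obtain a b where ab: "a \<in> C" "b \<notin> C" "b < n" "eps C = (a, b) \<or> eps C = (b, a)" "eps C \<in> E"
        by (auto simp: leave_def)
      have "a \<in> U" using CC ab(1) comp_sub by (auto simp: CC_def)
      then have "b \<notin> U" using nf ab(4) by (auto simp: far_def)
      then have "card (X b) < card (X a)" using \<open>a \<in> U\<close> U(1) ab(3) by auto
      then show ?thesis using ab by (auto simp: receiver_def sender_def)
    qed
    have inj: "inj_on (\<lambda>C. receiver X (eps C)) C2"
    proof (rule inj_onI)
      fix C D assume CD: "C \<in> C2" "D \<in> C2" "receiver X (eps C) = receiver X (eps D)"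
      then have "receiver X (eps C) \<in> C" "receiver X (eps C) \<in> D" using bd by metis+
      moreover have "C \<in> CC" "D \<in> CC" using CD by (auto simp: C2_def)
      ultimately show "C = D" using comp_eq unfolding CC_def by blast
    qed
    define F where "F = eps ` C2"
    have finF: "finite F" using finCC by (simp add: F_def C2_def)
    have "inj_on eps C2" using inj by (auto simp: inj_on_def)
    then have cF: "card F = card C2" by (simp add: F_def card_image)
    have injF: "e = e'" if "e \<in> F" "e' \<in> F" "receiver X e = receiver X e'" for e e'
      using that inj by (auto simp: F_def inj_on_def)
    have "card CC \<le> 2 * card F" using False CC_split cF by simp
    then have "card U \<le> 2 * card F * g" using U_le by (meson le_trans mult_le_mono1)
    then have "card U \<le> 2 * (g * card F)" by (simp only: mult_ac)
    then have "min (card U) h \<le> 32 * (g * card F)" by simp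
    then have "min (card U) h \<le> 32 * g * card F" by (simp only: mult_ac)
    then have "real (min (card U) h) \<le> 32 * g * card F"
      using of_nat_mono[of "min (card U) h" "32 * g * card F"] by simp
    moreover have "card {e' \<in> F - {e}. receiver X e' = receiver X e} = 0" if "e \<in> F" for e
    proof -
      have "{e' \<in> F - {e}. receiver X e' = receiver X e} = {}" using injF that by blast
      then show ?thesis by (metis card.empty)
    qed
    moreover have "card {e \<in> F. receiver X e = u} \<le> h div (16 * g)" for u
    proof -
      have "card {e \<in> F. receiver X e = u} \<le> Suc 0"
        using injF finF by (intro card_le_Suc0_iff_eq[THEN iffD2]) auto
      then show ?thesis using m1 unfolding m_def by linarith
    qed
    moreover have "receiver X e \<in> U" "e \<in> E" if "e \<in> F" for e
      using that bd comp_sub by (auto simp: F_def C2_def CC_def)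
    moreover have "X (receiver X e) - X (sender X e) \<noteq> {}" if "e \<in> F" for e
    proof -
      have "card (X (sender X e)) < card (X (receiver X e))" using that bd by (auto simp: F_def)
      moreover have "finite (X (sender X e))" using finX \<open>e \<in> F \<Longrightarrow> e \<in> E\<close> that by (simp add: sender_def)
      ultimately show ?thesis by (metis Diff_eq_empty_iff card_mono linorder_not_less)
    qed
    ultimately show thesis by (intro that[of F]) auto
  qed
qed

section \<open>Expected number of distinct outcomes\<close>

lemma expectation_bind_pmf_finite:
  fixes f :: "'b \<Rightarrow> real"
  assumes "finite (set_pmf p)" "\<And>x. x \<in> set_pmf p \<Longrightarrow> finite (set_pmf (q x))"
  shows "measure_pmf.expectation (bind_pmf p q) f =
    measure_pmf.expectation p (\<lambda>x. measure_pmf.expectation (q x) f)"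
proof -
  \<comment> \<open>Off the support of \<open>p\<close> the distributions \<open>q x\<close> may
    have infinite support; a dummy value there makes all of them finitely supported and leaves the
    composition unchanged.\<close>
  define q' where "q' x = (if x \<in> set_pmf p then q x else return_pmf undefined)" for x
  have "bind_pmf p q = bind_pmf p q'" by (intro bind_pmf_cong) (auto simp: q'_def)
  then have "measure_pmf.expectation (bind_pmf p q) f =
      (\<Sum>a\<in>set_pmf p. pmf p a *\<^sub>R measure_pmf.expectation (q' a) f)"
    using assms by (simp only:) (intro pmf_expectation_bind, auto simp: q'_def)
  also have "\<dots> = (\<Sum>a\<in>set_pmf p. measure_pmf.expectation (q a) f * pmf p a)"
    by (intro sum.cong) (auto simp: q'_def)
  also have "\<dots> = measure_pmf.expectation p (\<lambda>x. measure_pmf.expectation (q x) f)"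
    by (intro integral_measure_pmf_real[symmetric] assms) auto
  finally show ?thesis .
qed

lemma expectation_mono_pmf_finite:
  fixes f g :: "'b \<Rightarrow> real"
  assumes "finite (set_pmf p)" "\<And>x. x \<in> set_pmf p \<Longrightarrow> f x \<le> g x"
  shows "measure_pmf.expectation p f \<le> measure_pmf.expectation p g"
  using assms by (intro integral_mono_AE integrable_measure_pmf_finite) (auto simp: AE_measure_pmf_iff)

lemma finite_set_Pi_pmf:
  assumes "finite A" "\<And>x. x \<in> A \<Longrightarrow> finite (set_pmf (D x))"
  shows "finite (set_pmf (Pi_pmf A d D))"
  using assms by (intro finite_subset[OF set_Pi_pmf_subset'[of A d D]] finite_PiE_dflt) auto

text \<open>Reveal the outcomes edge by edge. Whatever the other edges produced, the next one adds
  an element outside their union with probability at least \<open>q\<close>, so the expected size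
  grows by at least \<open>q\<close>. The hypothesis fixes the outcomes of all other edges of
  \<open>F\<close>, which covers the union over those revealed so far.\<close>

lemma expected_card_UN_ge:
  fixes Z :: "'e \<Rightarrow> 'b \<Rightarrow> 'z set" and q :: real
  assumes "finite F"
    and D: "\<And>e. e \<in> F \<Longrightarrow> finite (set_pmf (D e))"
    and Z: "\<And>e y. finite (Z e y)"
    and new: "\<And>e c. e \<in> F \<Longrightarrow>
      q \<le> measure_pmf.prob (D e) {y. \<not> Z e y \<subseteq> (\<Union>e'\<in>F - {e}. Z e' (c e'))}"
  shows "q * card F \<le> measure_pmf.expectation (Pi_pmf F d D) (\<lambda>c. real (card (\<Union>e\<in>F. Z e (c e))))"
proof -
  have "q * card G \<le> measure_pmf.expectation (Pi_pmf G d D) (\<lambda>c. real (card (\<Union>e\<in>G. Z e (c e))))"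
    if "finite G" "G \<subseteq> F" for G
    using that
  proof (induction G rule: finite_induct)
    case empty
    then show ?case by simp
  next
    case (insert e G)
    let ?P = "Pi_pmf G d D"
    have finP: "finite (set_pmf ?P)" using insert D by (intro finite_set_Pi_pmf) auto
    have e: "e \<in> F" using insert by auto
    have step: "real (card (\<Union>e\<in>G. Z e (c e))) + q \<le>
      measure_pmf.expectation (D e) (\<lambda>y. real (card (\<Union>e'\<in>insert e G. Z e' ((c(e := y)) e'))))" for c
    proof -
      let ?B = "\<Union>e\<in>G. Z e (c e)"
      let ?N = "{y. \<not> Z e y \<subseteq> ?B}"
      have "q \<le> measure_pmf.prob (D e) {y. \<not> Z e y \<subseteq> (\<Union>e'\<in>F - {e}. Z e' (c e'))}"
        by (rule new[OF e])
      also have "\<dots> \<le> measure_pmf.prob (D e) ?N"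
      proof -
        have "?B \<subseteq> (\<Union>e'\<in>F - {e}. Z e' (c e'))" using insert by blast
        then have "{y. \<not> Z e y \<subseteq> (\<Union>e'\<in>F - {e}. Z e' (c e'))} \<subseteq> ?N" by blast
        then show ?thesis by (intro measure_pmf.finite_measure_mono) simp_all
      qed
      finally have "card ?B + q \<le> card ?B + measure_pmf.prob (D e) ?N" by simp
      also have "\<dots> = measure_pmf.expectation (D e) (\<lambda>y. real (card ?B) + indicator ?N y)"
        using D[OF e] by (subst Bochner_Integration.integral_add)
          (auto intro: integrable_measure_pmf_finite)
      also have "\<dots> \<le> measure_pmf.expectation (D e)
          (\<lambda>y. real (card (\<Union>e'\<in>insert e G. Z e' ((c(e := y)) e'))))"
      proof (intro expectation_mono_pmf_finite D e)
        fix y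
        have "e' \<noteq> e" if "e' \<in> G" for e' using insert that by auto
        then have eq: "(\<Union>e'\<in>insert e G. Z e' ((c(e := y)) e')) = ?B \<union> Z e y"
          by auto
        have fin: "finite (?B \<union> Z e y)" using insert Z by auto
        show "real (card ?B) + indicator ?N y \<le> real (card (\<Union>e'\<in>insert e G. Z e' ((c(e := y)) e')))"
        proof (cases "y \<in> ?N")
          case True
          then have "?B \<subset> ?B \<union> Z e y" by auto
          from psubset_card_mono[OF fin this] True show ?thesis unfolding eq by simp
        next
          case False
          then show ?thesis unfolding eq using card_mono[OF fin, of ?B] by simp
        qed
      qed
      finally show ?thesis .
    qed
    have "q * card (insert e G) = q * card G + q" using insert by (simp add: algebra_simps)
    also have "\<dots> \<le> measure_pmf.expectation ?P (\<lambda>c. real (card (\<Union>e\<in>G. Z e (c e)))) + q"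
      using insert by simp
    also have "\<dots> = measure_pmf.expectation ?P (\<lambda>c. real (card (\<Union>e\<in>G. Z e (c e))) + q)"
      using finP by (subst Bochner_Integration.integral_add) (auto intro: integrable_measure_pmf_finite)
    also have "\<dots> \<le> measure_pmf.expectation ?P (\<lambda>c. measure_pmf.expectation (D e)
         (\<lambda>y. real (card (\<Union>e'\<in>insert e G. Z e' ((c(e := y)) e')))))"
      using finP step by (intro expectation_mono_pmf_finite)
    also have "\<dots> = measure_pmf.expectation (Pi_pmf (insert e G) d D)
        (\<lambda>c. real (card (\<Union>e'\<in>insert e G. Z e' (c e'))))"
    proof -
      \<comment> \<open>Independence lets \<open>e\<close> be drawn last, after the outcomes on
        \<open>G\<close>.\<close>
      have "Pi_pmf (insert e G) d D = bind_pmf ?P (\<lambda>c. map_pmf (\<lambda>y. c(e := y)) (D e))"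
        using insert by (subst Pi_pmf_insert', simp, simp, subst bind_commute_pmf) (simp add: map_pmf_def)
      then show ?thesis using finP D[OF e] by (simp add: expectation_bind_pmf_finite)
    qed
    finally show ?case .
  qed
  then show ?thesis using assms(1) by blast
qed

lemma prob_sample_token:
  assumes "finite (S (fst e))" "finite (S (snd e))" "sym_diff (S (fst e)) (S (snd e)) \<noteq> {}"
  shows "measure_pmf.prob (sample_token S e) {y. \<exists>t\<in>B. y = Some t} =
    card (sym_diff (S (fst e)) (S (snd e)) \<inter> B) / card (sym_diff (S (fst e)) (S (snd e)))"
proof -
  have "(Some -` {y. \<exists>t\<in>B. y = Some t}) = B" by auto
  then show ?thesis using assms
    by (simp add: sample_token_def Let_def measure_pmf_of_set Int_commute)
qed

lemma finite_set_sample_token: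
  assumes "finite (S (fst e))" "finite (S (snd e))"
  shows "finite (set_pmf (sample_token S e))"
  using assms by (simp add: sample_token_def Let_def)

definition missing :: "nat set \<Rightarrow> config \<Rightarrow> nat \<Rightarrow> nat" where
  "missing P S u = card (P - S u)"

lemma deliver_learns:
  assumes "e \<in> E" "c e = Some t" "t \<in> S (sender X e)"
  shows "t \<in> deliver S E c (receiver X e)"
  using assms by (cases e) (auto simp: deliver_def sender_def receiver_def)

lemma deliver_superset: "S u \<subseteq> deliver S E c u"
  by (auto simp: deliver_def)

text \<open>The edges of \<open>receiving_edges\<close> each succeed with probability at least 1/4:
  a factor 1/2 for the direction of the token and 1/2 for avoiding coincidences; with the factor 32
  this gives 128. What a node learns is truncated at \<open>missing P S u div (16 * g)\<close>, the
  range in which \<open>weight_stable\<close> controls the weights.\<close>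

lemma expected_learning:
  assumes conn: "connected_graph n E" and finP: "finite P"
    and SP: "\<And>u. u < n \<Longrightarrow> S u \<subseteq> P"
    and good: "\<And>W. W \<subseteq> {..<n} \<Longrightarrow> card W = g \<Longrightarrow> card (\<Inter>w\<in>W. P - S w) < g"
    and g: "0 < g" "g \<le> n" "16 * g \<le> h"
    and U: "U = {u. u < n \<and> h \<le> missing P S u}"
  shows "real (min (card U) h) / (128 * g) \<le> measure_pmf.expectation (sample_transfer S E)
    (\<lambda>c. \<Sum>u\<in>U. real (min (missing P S u - missing P (deliver S E c) u) (missing P S u div (16 * g))))"
    (is "_ \<le> measure_pmf.expectation _ ?learn")
proof (cases "U = {}")
  case True
  then show ?thesis by simp
next
  case False
  define X where "X u = P - S u" for u
  have finX: "finite (X u)" for u using finP by (simp add: X_def)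
  have Esub: "E \<subseteq> {(u, v). u < v \<and> v < n}" using conn by (auto simp: connected_graph_def)
  have finE: "finite E"
    by (rule finite_subset[OF Esub], rule finite_subset[of _ "{..<n} \<times> {..<n}"]) auto
  have finS: "finite (S (fst e))" "finite (S (snd e))" if "e \<in> E" for e
  proof -
    have "fst e < n" "snd e < n" using Esub that by auto
    then show "finite (S (fst e))" "finite (S (snd e))"
      using SP finP by (auto intro: finite_subset)
  qed
  have finU: "finite U" using U by auto
  obtain F where F: "F \<subseteq> E" "real (min (card U) h) \<le> 32 * g * card F"
    "\<And>e. e \<in> F \<Longrightarrow> receiver X e \<in> U"
    "\<And>e. e \<in> F \<Longrightarrow> X (receiver X e) - X (sender X e) \<noteq> {}"
    "\<And>e. e \<in> F \<Longrightarrow> 2 * card {e' \<in> F - {e}. receiver X e' = receiver X e}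
        \<le> card (X (receiver X e) - X (sender X e))"
    "\<And>u. card {e \<in> F. receiver X e = u} \<le> h div (16 * g)"
    by (rule receiving_edges[OF conn, of X g h U])
      (use finX good g U False in \<open>auto simp: X_def missing_def\<close>)
  define A where "A e = X (receiver X e) - X (sender X e)" for e
  \<comment> \<open>Pairing a token with its receiver makes the union over \<open>F\<close> count
    two edges bringing the same token to one node only once.\<close>
  define Z where "Z e y = (case y of Some t \<Rightarrow> if t \<in> A e then {(receiver X e, t)} else {} | None \<Rightarrow> {})"
    for e and y :: "nat option"
  have finF: "finite F" using F(1) finE finite_subset by blast
  have Z_iff: "(u, t) \<in> Z e y \<longleftrightarrow> y = Some t \<and> t \<in> A e \<and> u = receiver X e" for u t e y
    by (auto simp: Z_def split: option.splits if_splits)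
  have new: "1 / 4 \<le> measure_pmf.prob (sample_token S e)
      {y. \<not> Z e y \<subseteq> (\<Union>e'\<in>F - {e}. Z e' (c e'))}" if e: "e \<in> F" for e c
  proof -
    let ?L = "\<Union>e'\<in>F - {e}. Z e' (c e')"
    let ?D = "sym_diff (S (fst e)) (S (snd e))"
    \<comment> \<open>The tokens of \<open>A e\<close> that no other selected edge brings to the
      same receiver. Only edges sharing that receiver can exclude a token, and each excludes at most
      one.\<close>
    define B where "B = {t \<in> A e. (receiver X e, t) \<notin> ?L}"
    have eE: "e \<in> E" using e F(1) by auto
    have nodes: "fst e < n" "snd e < n" using eE Esub by auto
    have D: "?D = sym_diff (X (fst e)) (X (snd e))"
      using SP[OF nodes(1)] SP[OF nodes(2)] by (auto simp: X_def)
    have finD: "finite ?D" using finS[OF eE] by auto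
    have AD: "A e \<subseteq> ?D" unfolding D A_def by (auto simp: receiver_def sender_def)
    then have finA: "finite (A e)" using finD finite_subset by blast
    have A0: "card (A e) > 0" using F(4)[OF e] finA by (simp add: A_def card_gt_0_iff)
    have "A e - B \<subseteq> (\<lambda>e'. the (c e')) ` {e' \<in> F - {e}. receiver X e' = receiver X e}"
    proof
      fix t assume "t \<in> A e - B"
      then obtain e' where e': "e' \<in> F - {e}" "(receiver X e, t) \<in> Z e' (c e')"
        by (auto simp: B_def)
      then show "t \<in> (\<lambda>e'. the (c e')) ` {e' \<in> F - {e}. receiver X e' = receiver X e}"
        by (intro image_eqI[of _ _ e']) (auto simp: Z_iff)
    qed
    then have "card (A e - B) \<le> card {e' \<in> F - {e}. receiver X e' = receiver X e}"
      using finF by (intro surj_card_le) auto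
    then have "2 * card (A e - B) \<le> card (A e)" using F(5)[OF e] unfolding A_def by linarith
    moreover have "card (A e) = card (A e - B) + card B"
    proof -
      have "B \<subseteq> A e" by (auto simp: B_def)
      then show ?thesis using finA
        by (simp add: card_Diff_subset card_mono finite_subset)
    qed
    moreover have "card ?D \<le> 2 * card (A e)"
      unfolding D A_def by (rule card_sym_diff_le_receiver) (simp_all add: finX)
    ultimately have "card ?D \<le> 4 * card B" by linarith
    moreover have "0 < card ?D" using A0 card_mono[OF finD AD] by linarith
    moreover have "?D \<inter> B = B" using AD by (auto simp: B_def)
    ultimately have "1 / 4 \<le> card (?D \<inter> B) / card ?D" by (simp add: field_simps)
    also have "\<dots> = measure_pmf.prob (sample_token S e) {y. \<exists>t\<in>B. y = Some t}"
      using finS[OF eE] \<open>0 < card ?D\<close> by (intro prob_sample_token[symmetric]) auto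
    also have "\<dots> \<le> measure_pmf.prob (sample_token S e) {y. \<not> Z e y \<subseteq> ?L}"
      by (intro measure_pmf.finite_measure_mono) (auto simp: B_def Z_iff subset_iff)
    finally show ?thesis .
  qed
  have finZ: "finite (Z e y)" for e y by (auto simp: Z_def split: option.splits)
  let ?card = "\<lambda>c. real (card (\<Union>e\<in>F. Z e (c e)))"
  have "real (min (card U) h) / (128 * g) \<le> 1 / 4 * card F"
    using F(2) g(1) by (simp add: field_simps)
  also have "\<dots> \<le> measure_pmf.expectation (Pi_pmf F None (sample_token S)) ?card"
    using finF finS F(1) finZ new
    by (intro expected_card_UN_ge) (auto intro!: finite_set_sample_token)
  also have "\<dots> = measure_pmf.expectation (sample_transfer S E) ?card"
  proof -
    have "(\<Union>e\<in>F. Z e (if e \<in> F then c e else None)) = (\<Union>e\<in>F. Z e (c e))" for c by auto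
    then show ?thesis unfolding sample_transfer_def Pi_pmf_subset[OF finE F(1)] by simp
  qed
  also have "\<dots> \<le> measure_pmf.expectation (sample_transfer S E) ?learn"
  proof (intro expectation_mono_pmf_finite)
    show "finite (set_pmf (sample_transfer S E))"
      unfolding sample_transfer_def using finE finS
      by (intro finite_set_Pi_pmf finite_set_sample_token)
    fix c
    define T where "T u = {t. (u, t) \<in> (\<Union>e\<in>F. Z e (c e))}" for u
    have "(\<Union>e\<in>F. Z e (c e)) \<subseteq> Sigma U T"
      using F(3) by (auto simp: T_def Z_iff)
    moreover have TX: "T u \<subseteq> X u - (P - deliver S E c u)" for u
    proof
      fix t assume "t \<in> T u"
      then obtain e where e: "e \<in> F" "c e = Some t" "t \<in> A e" "u = receiver X e"
        by (auto simp: T_def Z_iff)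
      then have "t \<in> X u" "t \<in> S (sender X e)" by (auto simp: A_def X_def)
      then show "t \<in> X u - (P - deliver S E c u)"
        using deliver_learns[of e E c t S X] e F(1) by auto
    qed
    have finT: "finite (T u)" for u using TX finX by (meson finite_Diff finite_subset)
    ultimately have "card (\<Union>e\<in>F. Z e (c e)) \<le> card (Sigma U T)"
      using finU by (intro card_mono finite_SigmaI) auto
    also have "\<dots> = (\<Sum>u\<in>U. card (T u))" using finU finT by (intro card_SigmaI) auto
    also have "\<dots> \<le> (\<Sum>u\<in>U. min (missing P S u - missing P (deliver S E c) u) (missing P S u div (16 * g)))"
    proof (intro sum_mono min.boundedI)
      fix u assume u: "u \<in> U"
      have "card (T u) \<le> card (X u - (P - deliver S E c u))" using TX finX by (intro card_mono) auto
      also have "\<dots> = missing P S u - missing P (deliver S E c) u"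
        unfolding missing_def X_def using finP deliver_superset[of S u E c]
        by (intro card_Diff_subset) auto
      finally show "card (T u) \<le> missing P S u - missing P (deliver S E c) u" .
      \<comment> \<open>Distinct tokens counted for \<open>u\<close> arrive over distinct selected
        edges, so the bound on edges per receiver gives the truncation.\<close>
      have "T u \<subseteq> (\<lambda>e. the (c e)) ` {e \<in> F. receiver X e = u}"
      proof
        fix t assume "t \<in> T u"
        then obtain e where "e \<in> F" "c e = Some t" "u = receiver X e"
          by (auto simp: T_def Z_iff)
        then show "t \<in> (\<lambda>e. the (c e)) ` {e \<in> F. receiver X e = u}"
          by (intro image_eqI[of _ _ e]) auto
      qed
      then have "card (T u) \<le> card {e \<in> F. receiver X e = u}"
        using finF by (intro surj_card_le) auto
      also have "\<dots> \<le> h div (16 * g)" by (rule F(6))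
      also have "\<dots> \<le> missing P S u div (16 * g)" using u U by (intro div_le_mono) auto
      finally show "card (T u) \<le> missing P S u div (16 * g)" .
    qed
    finally show "?card c \<le> ?learn c" by (simp only: of_nat_le_iff flip: of_nat_sum)
  qed
  finally show ?thesis .
qed

section \<open>The potential and its drift\<close>

text \<open>The power gives slope at least \<open>g / (2 h)\<close> while \<open>h \<le> 1024 n\<close>, where the number of nodes may
  exceed \<open>h\<close>. Above that the exponential suffices, so that \<open>ln (weight n k g k)\<close> is only
  \<open>O(g ln (min k n))\<close>; this matters if \<open>k\<close> is superpolynomial in \<open>n\<close>.\<close>

definition weight :: "nat \<Rightarrow> nat \<Rightarrow> nat \<Rightarrow> nat \<Rightarrow> real" where
  "weight n k g h = real (min h (1024 * n)) ^ g * exp (real g * real h / real (n + k))"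

definition node_potential :: "nat \<Rightarrow> nat \<Rightarrow> nat \<Rightarrow> nat \<Rightarrow> real" where
  "node_potential n k g x = (\<Sum>h = 1..x. weight n k g h)"

lemma weight_nonneg [simp]: "0 \<le> weight n k g h"
  by (simp add: weight_def)

lemma weight_mono: "h \<le> h' \<Longrightarrow> weight n k g h \<le> weight n k g h'"
  unfolding weight_def
  by (intro mult_mono power_mono) (auto intro!: divide_right_mono mult_left_mono)

lemma node_potential_mono: "x \<le> y \<Longrightarrow> node_potential n k g x \<le> node_potential n k g y"
  unfolding node_potential_def by (intro sum_mono2) auto

lemma exp_minus_le_half:
  fixes z :: real
  assumes "0 \<le> z" "z \<le> 1"
  shows "exp (- z) \<le> 1 - z / 2"
proof -
  have "z * z \<le> z" using assms by (simp add: mult_left_le)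
  have "1 \<le> (1 - z / 2) * (1 + z)" using \<open>z * z \<le> z\<close> by (simp add: algebra_simps)
  also have "\<dots> \<le> (1 - z / 2) * exp z" using assms by (intro mult_left_mono) auto
  finally show ?thesis by (simp add: exp_minus field_simps)
qed

text \<open>The factor \<open>1 / (2 (n + k))\<close> comes from \<open>min N h / h \<ge> N / (n + k)\<close> for \<open>N \<le> n\<close> and \<open>h \<le> k\<close>.\<close>

lemma weight_increment:
  fixes g n h k N :: nat
  assumes g: "0 < g" "g \<le> n" and h: "g \<le> h" "h \<le> k" and N: "N \<le> n"
  shows "g / (2 * real (n + k)) * (real N * weight n k g h)
    \<le> (weight n k g h - weight n k g (h - 1)) * real (min N h)"
proof -
  have h1: "1 \<le> h" "0 < real h" using g h by auto
  have nk: "0 < real (n + k)" using g by simp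
  define M where "M = 1024 * n"
  show ?thesis
  proof (cases "h \<le> M")
    case True
    \<comment> \<open>Below the cap the power alone shrinks by
      \<open>(1 - 1 / h) ^ g \<le> exp (- (g / h))\<close>; of the exponential factor only
      monotonicity enters.\<close>
    have "real (h - 1) = (1 - 1 / h) * h" using h1 by (simp add: field_simps)
    then have "real (h - 1) \<le> exp (- 1 / h) * h"
      using exp_ge_add_one_self[of "- 1 / h"] h1 by (simp add: mult_right_mono)
    then have "real (h - 1) ^ g \<le> (exp (- 1 / h) * h) ^ g" by (intro power_mono) auto
    also have "\<dots> = exp (- (g / h)) * h ^ g"
      by (simp add: power_mult_distrib flip: exp_of_nat_mult)
    finally have "real (h - 1) ^ g \<le> exp (- (g / h)) * h ^ g" .
    moreover have "exp (real g * real (h - 1) / real (n + k)) \<le> exp (real g * real h / real (n + k))"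
      by (auto intro!: divide_right_mono mult_left_mono)
    ultimately have "real (h - 1) ^ g * exp (real g * real (h - 1) / real (n + k))
      \<le> (exp (- (g / h)) * h ^ g) * exp (real g * real h / real (n + k))"
      by (intro mult_mono) auto
    moreover have "min h (1024 * n) = h" "min (h - 1) (1024 * n) = h - 1"
      using True by (auto simp: M_def)
    ultimately have "weight n k g (h - 1) \<le> exp (- (g / h)) * weight n k g h"
      unfolding weight_def by (simp add: mult.assoc)
    also have "\<dots> \<le> (1 - (g / h) / 2) * weight n k g h"
      using h1 h by (intro mult_right_mono exp_minus_le_half) auto
    finally have diff: "g / (2 * h) * weight n k g h \<le> weight n k g h - weight n k g (h - 1)"
      by (simp add: algebra_simps)
    have "real N / real (n + k) \<le> real (min N h) / real h"
    proof (cases "N \<le> h")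
      case True
      then show ?thesis using h h1 by (auto intro!: divide_left_mono mult_pos_pos)
    next
      case False
      then show ?thesis using N h1 nk by (simp add: divide_le_eq_1)
    qed
    then have "g / 2 * weight n k g h * (real N / real (n + k)) \<le> g / 2 * weight n k g h * (real (min N h) / real h)"
      by (intro mult_left_mono) auto
    then have "g / (2 * real (n + k)) * (real N * weight n k g h) \<le> (g / (2 * h) * weight n k g h) * real (min N h)"
      by (simp add: mult_ac)
    also have "\<dots> \<le> (weight n k g h - weight n k g (h - 1)) * real (min N h)"
      using diff by (intro mult_right_mono) auto
    finally show ?thesis .
  next
    case False
    \<comment> \<open>Above the cap the exponential factor provides the decrease, and
      \<open>N \<le> n < h\<close> turns the minimum into \<open>N\<close>.\<close>
    have "real (min (h - 1) M) ^ g \<le> real (min h M) ^ g" by (intro power_mono) auto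
    moreover have "real g * real (h - 1) / real (n + k) = - (g / real (n + k)) + real g * real h / real (n + k)"
    proof -
      have "real (h - 1) = real h - 1" using h1 by simp
      then show ?thesis by (simp add: right_diff_distrib diff_divide_distrib)
    qed
    then have "exp (real g * real (h - 1) / real (n + k)) =
        exp (- (g / real (n + k))) * exp (real g * real h / real (n + k))"
      by (simp only: exp_add)
    ultimately have "weight n k g (h - 1) \<le> exp (- (g / real (n + k))) * weight n k g h"
      unfolding weight_def M_def by (simp add: mult_ac mult_left_mono)
    also have "\<dots> \<le> (1 - (g / real (n + k)) / 2) * weight n k g h"
      using g nk by (intro mult_right_mono exp_minus_le_half) (auto simp: divide_le_eq_1)
    finally have "g / (2 * real (n + k)) * weight n k g h \<le> weight n k g h - weight n k g (h - 1)"
      by (simp add: algebra_simps)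
    then have "(g / (2 * real (n + k)) * weight n k g h) * N \<le> (weight n k g h - weight n k g (h - 1)) * N"
      by (intro mult_right_mono) auto
    moreover have "min N h = N" using False N by (auto simp: M_def)
    ultimately show ?thesis by (simp add: mult_ac)
  qed
qed

text \<open>Decreasing \<open>h\<close> by at most the fraction \<open>1 / (16 * g)\<close> keeps at
  least 15/16 of the power, by Bernoulli's inequality, and at least 15/16 of the exponential; the
  square of 15/16 exceeds 3/4.\<close>

lemma weight_stable:
  fixes g n h k j :: nat
  assumes g: "0 < g" and h: "h \<le> k" "j \<le> h div (16 * g)"
  shows "3 / 4 * weight n k g h \<le> weight n k g (h - j)"
proof (cases "h = 0")
  case True
  then show ?thesis using h by simp
next
  case False
  define M where "M = 1024 * n"
  have "16 * g * j \<le> 16 * g * (h div (16 * g))" using h by (intro mult_le_mono2)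
  also have "\<dots> \<le> h" by simp
  finally have "16 * g * j \<le> h" .
  then have "16 * real g * real j \<le> real h" by (metis of_nat_le_iff of_nat_mult of_nat_numeral)
  then have gj: "g * j / h \<le> (1 / 16 :: real)" using False by (simp add: field_simps)
  have jh: "j \<le> h" using h(2) by (meson div_le_dividend le_trans)
  have "(1 - j / h) * real (min h M) \<le> real (min (h - j) M)"
  proof (cases "h - j \<le> M")
    case True
    have "(1 - j / h) * real (min h M) \<le> (1 - j / h) * h"
      using jh False by (intro mult_left_mono) (auto simp: field_simps)
    also have "\<dots> = h - j" using False jh by (simp add: field_simps)
    finally show ?thesis using True jh by (simp add: of_nat_diff)
  next
    case False
    have "(1 - j / h) * real (min h M) \<le> 1 * real (min h M)" by (intro mult_right_mono) auto
    then show ?thesis using False by simp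
  qed
  moreover have "0 \<le> 1 - j / h" using jh by (cases "h = 0") (auto simp: field_simps)
  ultimately have "((1 - j / h) * real (min h M)) ^ g \<le> real (min (h - j) M) ^ g"
    by (intro power_mono) auto
  moreover have "15 / 16 \<le> (1 - real j / h) ^ g"
  proof -
    have "1 + real g * - (real j / h) \<le> (1 + - (real j / h)) ^ g"
      using \<open>0 \<le> 1 - j / h\<close> by (intro Bernoulli_inequality) simp
    moreover have "real g * - (real j / h) = - (g * j / h)" by simp
    moreover have "(1 + - (real j / real h)) ^ g = (1 - real j / real h) ^ g" by simp
    ultimately show ?thesis using gj by linarith
  qed
  ultimately have 1: "15 / 16 * real (min h M) ^ g \<le> real (min (h - j) M) ^ g"
    by (smt (verit) mult_right_mono power_mult_distrib zero_le_power of_nat_0_le_iff)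
  have nk: "0 < real (n + k)" using False h by simp
  have "g * j / real (n + k) \<le> g * j / h" using h False by (intro divide_left_mono) auto
  then have "15 / 16 \<le> 1 + - (g * j / real (n + k))" using gj by linarith
  also have "\<dots> \<le> exp (- (g * j / real (n + k)))" by (rule exp_ge_add_one_self)
  finally have "15 / 16 * exp (real g * real h / real (n + k)) \<le>
      exp (- (g * j / real (n + k))) * exp (real g * real h / real (n + k))"
    by (intro mult_right_mono) auto
  also have "\<dots> = exp (- (g * j / real (n + k)) + real g * real h / real (n + k))"
    by (simp only: exp_add)
  also have "- (g * j / real (n + k)) + real g * real h / real (n + k) = real g * real (h - j) / real (n + k)"
  proof -
    have "real (h - j) = real h - real j" using jh by simp
    then show ?thesis by (simp add: right_diff_distrib diff_divide_distrib)
  qed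
  finally have "(15 / 16 * real (min h M) ^ g) * (15 / 16 * exp (real g * real h / real (n + k)))
      \<le> weight n k g (h - j)"
    using 1 unfolding weight_def M_def by (intro mult_mono) auto
  moreover have "(15 / 16 * real (min h M) ^ g) * (15 / 16 * exp (real g * real h / real (n + k)))
      = 15 / 16 * (15 / 16) * weight n k g h"
    by (simp add: weight_def M_def)
  moreover have "3 / 4 * weight n k g h \<le> 15 / 16 * (15 / 16) * weight n k g h"
    by (intro mult_right_mono) auto
  ultimately show ?thesis by linarith
qed

text \<open>Only the top \<open>min d (x div (16 * g))\<close> of the removed levels are counted;
  they all have at least 3/4 of the weight of level \<open>x\<close>.\<close>

lemma node_potential_drop:
  fixes g n x k d :: nat
  assumes g: "0 < g" and x: "x \<le> k" "d \<le> x"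
  shows "3 / 4 * weight n k g x * real (min d (x div (16 * g)))
    \<le> node_potential n k g x - node_potential n k g (x - d)"
proof -
  define j where "j = min d (x div (16 * g))"
  have j: "j \<le> d" "j \<le> x" "j \<le> x div (16 * g)" using x by (auto simp: j_def)
  have "{1..x} = {1..x - j} \<union> {x - j<..x}" using j by auto
  then have split: "node_potential n k g x = node_potential n k g (x - j) + (\<Sum>h\<in>{x - j<..x}. weight n k g h)"
    unfolding node_potential_def by (metis (no_types, lifting) finite_atLeastAtMost
        finite_greaterThanAtMost ivl_disj_int_two(8) sum.union_disjoint)
  have "3 / 4 * weight n k g x * j = (\<Sum>h\<in>{x - j<..x}. 3 / 4 * weight n k g x)"
    using j by simp
  also have "\<dots> \<le> (\<Sum>h\<in>{x - j<..x}. weight n k g h)"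
  proof (intro sum_mono)
    fix h assume h: "h \<in> {x - j<..x}"
    then have "3 / 4 * weight n k g x \<le> weight n k g (x - (x - h))"
      using j g x by (intro weight_stable) auto
    then show "3 / 4 * weight n k g x \<le> weight n k g h" using h by simp
  qed
  finally have "3 / 4 * weight n k g x * j \<le> node_potential n k g x - node_potential n k g (x - j)"
    using split by simp
  also have "\<dots> \<le> node_potential n k g x - node_potential n k g (x - d)"
    using j by (simp add: node_potential_mono)
  finally show ?thesis by (simp add: j_def)
qed

definition potential :: "nat \<Rightarrow> nat \<Rightarrow> nat \<Rightarrow> nat set \<Rightarrow> config \<Rightarrow> real" where
  "potential n k g P S = (\<Sum>u<n. node_potential n k g (missing P S u))"

lemma missing_deliver_le: "finite P \<Longrightarrow> missing P (deliver S E c) u \<le> missing P S u"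
  unfolding missing_def using deliver_superset[of S u E c] by (intro card_mono) auto

lemma finite_set_sample_transfer:
  assumes "connected_graph n E" "finite P" "\<And>u. u < n \<Longrightarrow> S u \<subseteq> P"
  shows "finite (set_pmf (sample_transfer S E))"
proof -
  have Esub: "E \<subseteq> {(u, v). u < v \<and> v < n}" using assms(1) by (auto simp: connected_graph_def)
  have "finite E"
    by (rule finite_subset[OF Esub], rule finite_subset[of _ "{..<n} \<times> {..<n}"]) auto
  moreover have "finite (S (fst e))" "finite (S (snd e))" if "e \<in> E" for e
  proof -
    have "fst e < n" "snd e < n" using Esub that by auto
    then show "finite (S (fst e))" "finite (S (snd e))"
      using assms by (auto intro: finite_subset)
  qed
  ultimately show ?thesis
    unfolding sample_transfer_def by (intro finite_set_Pi_pmf finite_set_sample_token) auto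
qed

text \<open>The weight of level \<open>x u\<close> dominates the sum of the increments up to it, so
  the drop of the potential is bounded below by a sum over levels \<open>h\<close> of increments
  times what \<open>U h\<close> learns. \<open>expected_learning\<close> and
  \<open>weight_increment\<close> turn each level into \<open>card (U h) * weight n k g h\<close> up
  to a factor, and these sum to the potential above level \<open>16 * g\<close>. The additive term
  accounts for the levels below, where \<open>expected_learning\<close> does not apply.\<close>

lemma potential_drift:
  assumes conn: "connected_graph n E" and P: "finite P" "card P \<le> k"
    and SP: "\<And>u. u < n \<Longrightarrow> S u \<subseteq> P"
    and good: "\<And>W. W \<subseteq> {..<n} \<Longrightarrow> card W = g \<Longrightarrow> card (\<Inter>w\<in>W. P - S w) < g"
    and g: "0 < g" "g \<le> n"
  shows "measure_pmf.expectation (sample_transfer S E) (\<lambda>c. potential n k g P (deliver S E c))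
    \<le> (1 - 1 / (512 * real (n + k))) * potential n k g P S
      + 1 / (512 * real (n + k)) * (n * node_potential n k g (16 * g))"
proof -
  let ?E = "measure_pmf.expectation (sample_transfer S E)"
  let ?w = "weight n k g"
  define x where "x u = missing P S u" for u
  define x' where "x' c u = missing P (deliver S E c) u" for c u
  define l where "l c u = min (x u - x' c u) (x u div (16 * g))" for c u
  define U where "U h = {u. u < n \<and> h \<le> x u}" for h
  define H where "H = {16 * g..k}"
  have fin: "finite (set_pmf (sample_transfer S E))"
    using finite_set_sample_transfer[OF conn P(1)] SP by blast
  have int: "integrable (sample_transfer S E) f" for f :: "transfer \<Rightarrow> real"
    using fin by (rule integrable_measure_pmf_finite)
  have xk: "x u \<le> k" for u
    unfolding x_def missing_def using P by (meson Diff_subset card_mono le_trans)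
  have U_sum: "(\<Sum>h\<in>H. \<Sum>u\<in>U h. f h u) = (\<Sum>u<n. \<Sum>h\<in>{16 * g..x u}. f h u)"
    for f :: "nat \<Rightarrow> nat \<Rightarrow> real"
  proof -
    have "(\<Sum>h\<in>H. \<Sum>u\<in>U h. f h u) = (\<Sum>h\<in>H. \<Sum>u | u \<in> {..<n} \<and> h \<le> x u. f h u)"
      by (simp add: U_def)
    also have "\<dots> = (\<Sum>u\<in>{..<n}. \<Sum>h | h \<in> H \<and> h \<le> x u. f h u)"
      by (rule sum.swap_restrict) (auto simp: H_def)
    finally have "(\<Sum>h\<in>H. \<Sum>u\<in>U h. f h u) = (\<Sum>u<n. \<Sum>h | h \<in> H \<and> h \<le> x u. f h u)" .
    moreover have "{h. h \<in> H \<and> h \<le> x u} = {16 * g..x u}" for u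
      using xk[of u] by (auto simp: H_def)
    ultimately show ?thesis by simp
  qed
  have drop: "3 / 4 * (\<Sum>h\<in>H. (?w h - ?w (h - 1)) * (\<Sum>u\<in>U h. real (l c u)))
      \<le> potential n k g P S - potential n k g P (deliver S E c)" for c
  proof -
    have "3 / 4 * (\<Sum>h\<in>H. (?w h - ?w (h - 1)) * (\<Sum>u\<in>U h. real (l c u)))
        = 3 / 4 * (\<Sum>u<n. (\<Sum>h\<in>{16 * g..x u}. (?w h - ?w (h - 1)) * real (l c u)))"
      unfolding sum_distrib_left[of "_ - _"] U_sum ..
    also have "\<dots> = (\<Sum>u<n. 3 / 4 * (\<Sum>h\<in>{16 * g..x u}. ?w h - ?w (h - 1)) * real (l c u))"
      by (simp add: sum_distrib_left sum_distrib_right mult_ac)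
    also have "\<dots> \<le> (\<Sum>u<n. 3 / 4 * ?w (x u) * real (l c u))"
    proof (intro sum_mono mult_right_mono mult_left_mono)
      fix u
      show "(\<Sum>h\<in>{16 * g..x u}. ?w h - ?w (h - 1)) \<le> ?w (x u)"
      proof (cases "16 * g \<le> x u")
        case True
        have "(\<Sum>h\<in>{16 * g..x u}. ?w h - ?w (h - 1)) = ?w (x u) - ?w (16 * g - 1)"
          using sum_telescope''[of "16 * g - 1" "x u" ?w] True g by simp
        then show ?thesis by simp
      qed simp
    qed auto
    also have "\<dots> \<le> (\<Sum>u<n. node_potential n k g (x u) - node_potential n k g (x' c u))"
    proof (intro sum_mono)
      fix u
      have "x' c u \<le> x u" unfolding x'_def x_def using P by (intro missing_deliver_le)
      then show "3 / 4 * ?w (x u) * real (l c u) \<le> node_potential n k g (x u) - node_potential n k g (x' c u)"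
        using node_potential_drop[OF g(1) xk[of u], of "x u - x' c u" n] by (simp add: l_def)
    qed
    also have "\<dots> = potential n k g P S - potential n k g P (deliver S E c)"
      by (simp add: potential_def x_def x'_def sum_subtractf)
    finally show ?thesis .
  qed
  have learn: "real (min (card (U h)) h) / (128 * g) \<le> ?E (\<lambda>c. \<Sum>u\<in>U h. real (l c u))" if "h \<in> H" for h
    unfolding l_def x_def x'_def
    by (rule expected_learning[OF conn P(1) SP good g]) (use that in \<open>auto simp: H_def U_def x_def\<close>)
  \<comment> \<open>The factor is 3/4 from \<open>node_potential_drop\<close>, times 1/128 from the
    learning bound, times 1/2 from the slope of the weights, that is 3/1024, of which 2/1024 is
    kept. Nodes below level \<open>16 * g\<close> contribute at most zero on the left.\<close>
  have "2 / (1024 * real (n + k)) * (\<Sum>u<n. node_potential n k g (x u) - node_potential n k g (16 * g))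
     \<le> 3 / (1024 * real (n + k)) * (\<Sum>u<n. \<Sum>h\<in>{16 * g..x u}. ?w h)"
  proof -
    have "node_potential n k g (x u) - node_potential n k g (16 * g) \<le> (\<Sum>h\<in>{16 * g..x u}. ?w h)" for u
    proof (cases "16 * g \<le> x u")
      case True
      then have "{1..x u} = {1..16 * g - 1} \<union> {16 * g..x u}" using g by auto
      moreover have "{1..16 * g - 1} \<inter> {16 * g..x u} = {}" by auto
      ultimately have "node_potential n k g (x u) = node_potential n k g (16 * g - 1) + (\<Sum>h\<in>{16 * g..x u}. ?w h)"
        unfolding node_potential_def by (simp add: sum.union_disjoint)
      moreover have "node_potential n k g (16 * g - 1) \<le> node_potential n k g (16 * g)"
        by (rule node_potential_mono) simp
      ultimately show ?thesis by simp
    next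
      case False
      then show ?thesis using node_potential_mono[of "x u" "16 * g" n k g]
        by (simp add: sum_nonneg)
    qed
    then have "(\<Sum>u<n. node_potential n k g (x u) - node_potential n k g (16 * g)) \<le> (\<Sum>u<n. \<Sum>h\<in>{16 * g..x u}. ?w h)"
      by (intro sum_mono)
    moreover have "0 \<le> (\<Sum>u<n. \<Sum>h\<in>{16 * g..x u}. ?w h)" by (intro sum_nonneg) auto
    ultimately have "2 / (1024 * real (n + k)) * (\<Sum>u<n. node_potential n k g (x u) - node_potential n k g (16 * g))
      \<le> 2 / (1024 * real (n + k)) * (\<Sum>u<n. \<Sum>h\<in>{16 * g..x u}. ?w h)"
      by (intro mult_left_mono) auto
    also have "\<dots> \<le> 3 / (1024 * real (n + k)) * (\<Sum>u<n. \<Sum>h\<in>{16 * g..x u}. ?w h)"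
      using \<open>0 \<le> (\<Sum>u<n. \<Sum>h\<in>{16 * g..x u}. ?w h)\<close>
      by (intro mult_right_mono divide_right_mono) auto
    finally show ?thesis .
  qed
  also have "\<dots> = 3 / (1024 * real (n + k)) * (\<Sum>h\<in>H. \<Sum>u\<in>U h. ?w h)"
    by (simp only: U_sum)
  also have "\<dots> = 3 / 4 * (\<Sum>h\<in>H. 1 / (128 * g) * (g / (2 * real (n + k)) * (real (card (U h)) * ?w h)))"
    using g by (simp add: sum_distrib_left)
  also have "\<dots> \<le> 3 / 4 * (\<Sum>h\<in>H. 1 / (128 * g) * ((?w h - ?w (h - 1)) * real (min (card (U h)) h)))"
  proof (intro mult_left_mono sum_mono weight_increment g)
    fix h assume "h \<in> H"
    show "card (U h) \<le> n" using card_mono[of "{..<n}" "U h"] by (auto simp: U_def)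
  qed (auto simp: H_def)
  also have "\<dots> = 3 / 4 * (\<Sum>h\<in>H. (?w h - ?w (h - 1)) * (real (min (card (U h)) h) / (128 * g)))"
    by (simp add: mult_ac)
  also have "\<dots> \<le> 3 / 4 * (\<Sum>h\<in>H. (?w h - ?w (h - 1)) * ?E (\<lambda>c. \<Sum>u\<in>U h. real (l c u)))"
    using learn by (intro mult_left_mono sum_mono) (auto simp: weight_mono)
  also have "\<dots> = ?E (\<lambda>c. 3 / 4 * (\<Sum>h\<in>H. (?w h - ?w (h - 1)) * (\<Sum>u\<in>U h. real (l c u))))"
    using int by (simp add: Bochner_Integration.integral_sum)
  also have "\<dots> \<le> ?E (\<lambda>c. potential n k g P S - potential n k g P (deliver S E c))"
    using fin drop by (intro expectation_mono_pmf_finite)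
  also have "\<dots> = potential n k g P S - ?E (\<lambda>c. potential n k g P (deliver S E c))"
    using int by (subst Bochner_Integration.integral_diff) auto
  finally have drift: "2 / (1024 * real (n + k)) * (\<Sum>u<n. node_potential n k g (x u) - node_potential n k g (16 * g))
      \<le> potential n k g P S - ?E (\<lambda>c. potential n k g P (deliver S E c))" .
  have "1 / (512 * real (n + k)) * (potential n k g P S - n * node_potential n k g (16 * g))
      \<le> potential n k g P S - ?E (\<lambda>c. potential n k g P (deliver S E c))"
  proof -
    have "2 / (1024 * r) = 1 / (512 * r)" for r :: real by simp
    with drift show ?thesis
      by (simp only: sum_subtractf sum_constant card_lessThan potential_def x_def)
  qed
  moreover have "e \<le> (1 - b) * p + b * q" if "b * (p - q) \<le> p - e" for b p q e :: real
    using that by (simp add: algebra_simps)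
  ultimately show ?thesis by blast
qed

section \<open>Evolution of the protocol\<close>

text \<open>Invariant of the execution. \<open>P\<close> stays the set of tokens present at the
  start, so that lacking does not refer to tokens that nobody holds; the third condition keeps every
  token of \<open>P\<close> obtainable.\<close>

definition mixed_state :: "nat \<Rightarrow> nat \<Rightarrow> nat set \<Rightarrow> config \<Rightarrow> bool" where
  "mixed_state n g P S \<longleftrightarrow> finite P \<and> (\<forall>u<n. S u \<subseteq> P) \<and> (\<forall>t\<in>P. \<exists>u<n. t \<in> S u) \<and>
     (\<forall>W\<subseteq>{..<n}. card W = g \<longrightarrow> card (\<Inter>w\<in>W. P - S w) < g)"

lemma mixed_state_deliver:
  assumes ok: "mixed_state n g P S" and conn: "connected_graph n E" and g: "0 < g"
  shows "mixed_state n g P (deliver S E c)"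
proof -
  have P: "finite P" and SP: "\<And>u. u < n \<Longrightarrow> S u \<subseteq> P" using ok by (auto simp: mixed_state_def)
  have Esub: "E \<subseteq> {(u, v). u < v \<and> v < n}" using conn by (auto simp: connected_graph_def)
  have "deliver S E c u \<subseteq> P" if "u < n" for u
  proof
    fix t assume "t \<in> deliver S E c u"
    then consider "t \<in> S u" | v where "(v, u) \<in> E \<or> (u, v) \<in> E" "t \<in> S v" by (auto simp: deliver_def)
    then show "t \<in> P"
    proof cases
      case 2
      then have "v < n" using Esub by auto
      then show ?thesis using 2 SP by auto
    qed (use SP that in auto)
  qed
  moreover have "card (\<Inter>w\<in>W. P - deliver S E c w) < g" if W: "W \<subseteq> {..<n}" "card W = g" for W
  proof -
    have "W \<noteq> {}" using W g by auto
    then have "finite (\<Inter>w\<in>W. P - S w)" using P by auto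
    then have "card (\<Inter>w\<in>W. P - deliver S E c w) \<le> card (\<Inter>w\<in>W. P - S w)"
      by (rule card_mono) (use deliver_superset[of S _ E c] in blast)
    also have "\<dots> < g" using ok W by (auto simp: mixed_state_def)
    finally show ?thesis .
  qed
  moreover have "\<exists>u<n. t \<in> deliver S E c u" if "t \<in> P" for t
    using ok that deliver_superset[of S _ E c] unfolding mixed_state_def by blast
  ultimately show ?thesis using P by (simp add: mixed_state_def)
qed

lemma exec_support:
  assumes "mixed_state n g P S0" "valid_adversary n adv" "0 < g"
  shows "finite (set_pmf (sym_diff_exec adv S0 T)) \<and>
    (\<forall>(h, S)\<in>set_pmf (sym_diff_exec adv S0 T). mixed_state n g P S)"
proof (induction T)
  case 0
  then show ?case using assms by simp
next
  case (Suc T)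
  have conn: "connected_graph n (adv h S)" for h S
    using assms(2) by (simp add: valid_adversary_def)
  have "finite (set_pmf (sample_transfer S (adv h S)))"
    if "(h, S) \<in> set_pmf (sym_diff_exec adv S0 T)" for h S
  proof -
    have "mixed_state n g P S" using Suc that by auto
    then show ?thesis
      by (intro finite_set_sample_transfer[OF conn, of P]) (simp_all add: mixed_state_def)
  qed
  moreover have "mixed_state n g P (deliver S (adv h S) c)"
    if "(h, S) \<in> set_pmf (sym_diff_exec adv S0 T)" for h S c
  proof -
    have "mixed_state n g P S" using Suc that by auto
    then show ?thesis by (rule mixed_state_deliver[OF _ conn assms(3)])
  qed
  ultimately show ?case using Suc by (auto simp: Let_def)
qed

text \<open>Given the history, the graph of the round is a fixed connected graph, chosen before the
  transfers are sampled. A one-round bound that holds for every connected graph therefore averages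
  over all histories, whatever the strategy of the adversary.\<close>

lemma expectation_exec_Suc_le:
  fixes f f' :: "config \<Rightarrow> real"
  assumes ok: "mixed_state n g P S0" "valid_adversary n adv" "0 < g"
    and step: "\<And>S E. mixed_state n g P S \<Longrightarrow> connected_graph n E \<Longrightarrow>
      measure_pmf.expectation (sample_transfer S E) (\<lambda>c. f' (deliver S E c)) \<le> f S"
  shows "measure_pmf.expectation (sym_diff_exec adv S0 (Suc T)) (\<lambda>(h, S). f' S)
    \<le> measure_pmf.expectation (sym_diff_exec adv S0 T) (\<lambda>(h, S). f S)"
proof -
  note sup = exec_support[OF ok, of T]
  have conn: "connected_graph n (adv h S)" for h S
    using ok(2) by (simp add: valid_adversary_def)
  have fin: "finite (set_pmf (sample_transfer S (adv h S)))"
    if "(h, S) \<in> set_pmf (sym_diff_exec adv S0 T)" for h S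
  proof -
    have "mixed_state n g P S" using sup that by auto
    then show ?thesis
      by (intro finite_set_sample_transfer[OF conn, of P]) (simp_all add: mixed_state_def)
  qed
  have "measure_pmf.expectation (sym_diff_exec adv S0 (Suc T)) (\<lambda>(h, S). f' S) =
    measure_pmf.expectation (sym_diff_exec adv S0 T) (\<lambda>(h, S).
      measure_pmf.expectation (sample_transfer S (adv h S)) (\<lambda>c. f' (deliver S (adv h S) c)))"
    unfolding sym_diff_exec.simps
    by (subst expectation_bind_pmf_finite) (use sup fin in \<open>auto simp: Let_def case_prod_unfold\<close>)
  also have "\<dots> \<le> measure_pmf.expectation (sym_diff_exec adv S0 T) (\<lambda>(h, S). f S)"
    using sup conn by (intro expectation_mono_pmf_finite) (auto intro!: step)
  finally show ?thesis .
qed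

text \<open>Iterates the affine map sending \<open>x\<close> to \<open>(1 - b) * x + b * B\<close>,
  whose fixed point is \<open>B\<close>.\<close>

lemma expected_potential_le:
  assumes ok: "mixed_state n g P S0" "valid_adversary n adv" and g: "0 < g" "g \<le> n"
    and P: "card P \<le> k"
  defines "b \<equiv> 1 / (512 * real (n + k))" and "B \<equiv> n * node_potential n k g (16 * g)"
  shows "measure_pmf.expectation (sym_diff_exec adv S0 T) (\<lambda>(h, S). potential n k g P S)
    \<le> (1 - b) ^ T * potential n k g P S0 + B"
proof (induction T)
  case 0
  have "0 \<le> B" unfolding B_def node_potential_def by (intro mult_nonneg_nonneg sum_nonneg) auto
  then show ?case by simp
next
  case (Suc T)
  let ?E = "\<lambda>T. measure_pmf.expectation (sym_diff_exec adv S0 T)"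
  have b: "0 \<le> b" "b \<le> 1" using g by (auto simp: b_def divide_le_eq_1)
  have fin: "finite (set_pmf (sym_diff_exec adv S0 T))"
    using exec_support[OF ok g(1), of T] by simp
  then have int: "integrable (sym_diff_exec adv S0 T) f" for f :: "history \<times> config \<Rightarrow> real"
    by (rule integrable_measure_pmf_finite)
  have "?E (Suc T) (\<lambda>(h, S). potential n k g P S) \<le> ?E T (\<lambda>(h, S). (1 - b) * potential n k g P S + b * B)"
  proof (rule expectation_exec_Suc_le[OF ok g(1)])
    fix S E assume S: "mixed_state n g P S" and E: "connected_graph n E"
    show "measure_pmf.expectation (sample_transfer S E) (\<lambda>c. potential n k g P (deliver S E c))
        \<le> (1 - b) * potential n k g P S + b * B"
      unfolding b_def B_def
      by (rule potential_drift[OF E _ P _ _ g]) (use S in \<open>auto simp: mixed_state_def\<close>)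
  qed
  also have "\<dots> = (1 - b) * ?E T (\<lambda>(h, S). potential n k g P S) + b * B"
  proof -
    have "(\<lambda>(h, S). (1 - b) * potential n k g P S + b * B) =
        (\<lambda>x :: history \<times> config. (1 - b) * (case x of (h, S) \<Rightarrow> potential n k g P S) + b * B)"
      by auto
    then show ?thesis by (simp only:) (simp add: int)
  qed
  also have "\<dots> \<le> (1 - b) * ((1 - b) ^ T * potential n k g P S0 + B) + b * B"
    using Suc b by (intro add_mono mult_left_mono) auto
  finally show ?case by (simp add: algebra_simps)
qed

section \<open>The deterministic final phase\<close>

definition total_missing :: "nat \<Rightarrow> nat set \<Rightarrow> config \<Rightarrow> nat" where
  "total_missing n P S = (\<Sum>u<n. missing P S u)"

text \<open>If some node lacks a token \<open>t\<close> of \<open>P\<close>, an edge joins a holder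
  of \<open>t\<close> to a non-holder. Its symmetric difference is nonempty, so some token, not
  necessarily \<open>t\<close>, surely crosses it and is new to its recipient.\<close>

lemma total_missing_decreases:
  assumes ok: "mixed_state n g P S" and conn: "connected_graph n E"
    and c: "c \<in> set_pmf (sample_transfer S E)" and pos: "0 < total_missing n P S"
  shows "total_missing n P (deliver S E c) < total_missing n P S"
proof -
  have P: "finite P" and SP: "\<And>u. u < n \<Longrightarrow> S u \<subseteq> P" using ok by (auto simp: mixed_state_def)
  have Esub: "E \<subseteq> {(u, v). u < v \<and> v < n}" using conn by (auto simp: connected_graph_def)
  have finE: "finite E"
    by (rule finite_subset[OF Esub], rule finite_subset[of _ "{..<n} \<times> {..<n}"]) auto
  obtain u where u: "u < n" "missing P S u \<noteq> 0"
    using pos unfolding total_missing_def by (metis lessThan_iff less_irrefl sum.neutral)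
  then obtain t where t: "t \<in> P" "t \<notin> S u" unfolding missing_def by (metis DiffE card.empty ex_in_conv)
  then obtain v where v: "v < n" "t \<in> S v" using ok by (auto simp: mixed_state_def)
  obtain a b where ab: "a \<in> {w. w < n \<and> t \<in> S w}" "b \<notin> {w. w < n \<and> t \<in> S w}" "a < n" "b < n"
    "(a, b) \<in> E \<union> E\<inverse>"
    by (rule crossing_edge[OF conn, of "{w. w < n \<and> t \<in> S w}" v u]) (use u v t in auto)
  then obtain e where e: "e \<in> E" "e = (a, b) \<or> e = (b, a)" by auto
  let ?D = "sym_diff (S (fst e)) (S (snd e))"
  have nodes: "fst e < n" "snd e < n" using e ab by auto
  have "finite (S (fst e))" "finite (S (snd e))" using nodes SP P finite_subset by blast+
  then have D: "?D \<noteq> {}" "finite ?D" using e(2) ab by auto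
  have "c e \<in> set_pmf (sample_token S e)"
    using c set_Pi_pmf_subset'[OF finE, of None "sample_token S"] e
    by (auto simp: sample_transfer_def PiE_dflt_def)
  moreover have "sample_token S e = map_pmf Some (pmf_of_set ?D)"
    unfolding sample_token_def Let_def using D(1) by (simp only: if_False)
  ultimately have "c e \<in> Some ` ?D" by (simp only: set_map_pmf set_pmf_of_set[OF D])
  then obtain s where s: "c e = Some s" "s \<in> ?D" by blast
  obtain w where w: "w < n" "s \<in> P" "s \<notin> S w" "s \<in> deliver S E c w"
  proof (cases "s \<in> S (fst e)")
    case True
    then show ?thesis using s e(1) nodes SP[OF nodes(1)]
      by (intro that[of "snd e"]) (auto simp: deliver_def intro!: exI[of _ "fst e"])
  next
    case False
    then show ?thesis using s e(1) nodes SP[OF nodes(2)]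
      by (intro that[of "fst e"]) (auto simp: deliver_def intro!: exI[of _ "snd e"])
  qed
  have "P - deliver S E c w \<subset> P - S w" using w deliver_superset[of S w E c] by blast
  then have "missing P (deliver S E c) w < missing P S w"
    unfolding missing_def using P by (intro psubset_card_mono) auto
  then show ?thesis unfolding total_missing_def
    using w(1) by (intro sum_strict_mono_ex1) (auto simp: missing_deliver_le[OF P])
qed

lemma prob_incomplete_le:
  assumes ok: "mixed_state n g P S0" "valid_adversary n adv" and g: "0 < g"
  shows "measure_pmf.prob (sym_diff_exec adv S0 (T + B)) {(h, S). total_missing n P S \<noteq> 0}
    \<le> measure_pmf.prob (sym_diff_exec adv S0 T) {(h, S). B < total_missing n P S}"
proof -
  \<comment> \<open>\<open>f j\<close> indicates being behind schedule: after \<open>j\<close>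
    rounds the total should be at most \<open>B - j\<close> or zero. The total falls every round
    until it is zero, so the expectation of \<open>f j\<close> does not grow when \<open>j\<close>
    and the round advance together. \<open>f 0\<close> is the event on the right, \<open>f B\<close>
    the one on the left.\<close>
  define f where "f j S = (indicator {S. \<not> (total_missing n P S + j \<le> B \<or> total_missing n P S = 0)} S :: real)"
    for j S
  have eq: "measure_pmf.prob p {(h, S). Q S} = measure_pmf.expectation p (\<lambda>(h, S). indicator {S. Q S} S)"
    for p :: "(history \<times> config) pmf" and Q
  proof -
    have "(\<lambda>(h :: history, S). indicator {S. Q S} S :: real) = indicator {(h, S). Q S}"
      by (auto simp: fun_eq_iff indicator_def)
    then show ?thesis by (simp only:) simp
  qed
  have step: "measure_pmf.expectation (sym_diff_exec adv S0 (Suc T)) (\<lambda>(h, S). f (Suc j) S)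
    \<le> measure_pmf.expectation (sym_diff_exec adv S0 T) (\<lambda>(h, S). f j S)" for T j
  proof (rule expectation_exec_Suc_le[OF ok g])
    fix S E assume S: "mixed_state n g P S" and E: "connected_graph n E"
    have P: "finite P" using S by (auto simp: mixed_state_def)
    have "measure_pmf.expectation (sample_transfer S E) (\<lambda>c. f (Suc j) (deliver S E c))
        \<le> measure_pmf.expectation (sample_transfer S E) (\<lambda>c. f j S)"
    proof (intro expectation_mono_pmf_finite)
      show "finite (set_pmf (sample_transfer S E))"
        using S by (intro finite_set_sample_transfer[OF E P]) (auto simp: mixed_state_def)
      fix c assume c: "c \<in> set_pmf (sample_transfer S E)"
      have "total_missing n P (deliver S E c) \<le> total_missing n P S"
        unfolding total_missing_def using missing_deliver_le[OF P] by (intro sum_mono)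
      then show "f (Suc j) (deliver S E c) \<le> f j S"
        using total_missing_decreases[OF S E c] by (auto simp: f_def indicator_def)
    qed
    then show "measure_pmf.expectation (sample_transfer S E) (\<lambda>c. f (Suc j) (deliver S E c)) \<le> f j S"
      by simp
  qed
  have "measure_pmf.expectation (sym_diff_exec adv S0 (T + j)) (\<lambda>(h, S). f j S)
      \<le> measure_pmf.expectation (sym_diff_exec adv S0 T) (\<lambda>(h, S). f 0 S)" for j
  proof (induction j)
    case (Suc j)
    then show ?case using step[of "T + j" j] by simp
  qed simp
  note bound = this[of B]
  have "f B S = indicator {S. total_missing n P S \<noteq> 0} S"
      "f 0 S = indicator {S. B < total_missing n P S} S" for S
    by (auto simp: f_def indicator_def)
  with bound show ?thesis by (simp only: eq)
qed

text \<open>Markov's inequality for the potential after \<open>T\<close> rounds: a total above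
  \<open>n * (1024 * g)\<close> forces some node to lack at least \<open>1024 * g\<close> tokens,
  hence a potential of at least \<open>F (1024 * g)\<close>. The other \<open>n * (1024 * g)\<close>
  rounds belong to the final phase.\<close>

lemma prob_not_spread_le:
  assumes ok: "mixed_state n g P S0" "valid_adversary n adv" and g: "0 < g" "g \<le> n"
    and P: "card P \<le> k"
  defines "F \<equiv> node_potential n k g"
  shows "measure_pmf.prob (sym_diff_exec adv S0 (T + n * (1024 * g))) {(h, S). total_missing n P S \<noteq> 0}
    \<le> ((1 - 1 / (512 * real (n + k))) ^ T * (n * F k) + n * F (16 * g)) / F (1024 * g)"
proof -
  have finP: "finite P" using ok by (simp add: mixed_state_def)
  let ?p = "sym_diff_exec adv S0 T"
  have fin: "finite (set_pmf ?p)" using exec_support[OF ok g(1), of T] by simp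
  have F0: "0 \<le> F x" for x unfolding F_def node_potential_def by (intro sum_nonneg) auto
  have Fpos: "0 < F (1024 * g)"
  proof -
    have "0 < weight n k g 1" using g by (simp add: weight_def)
    also have "\<dots> = F 1" by (simp add: F_def node_potential_def)
    also have "\<dots> \<le> F (1024 * g)" unfolding F_def using g by (intro node_potential_mono) simp
    finally show ?thesis .
  qed
  have "indicator {(h, S). n * (1024 * g) < total_missing n P S} hS
      \<le> (\<lambda>(h, S). potential n k g P S) hS / F (1024 * g)" for hS :: "history \<times> config"
  proof (cases hS)
    case (Pair h S)
    have pot: "potential n k g P S \<ge> 0"
      unfolding potential_def F_def[symmetric] by (intro sum_nonneg F0)
    show ?thesis
    proof (cases "n * (1024 * g) < total_missing n P S")
      case True
      have "\<exists>u<n. 1024 * g \<le> missing P S u"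
      proof (rule ccontr)
        assume "\<not> ?thesis"
        then have "total_missing n P S \<le> (\<Sum>u<n. 1024 * g)"
          unfolding total_missing_def by (intro sum_mono) auto
        then show False using True by simp
      qed
      then obtain u where u: "u < n" "1024 * g \<le> missing P S u" by auto
      have "F (1024 * g) \<le> F (missing P S u)" unfolding F_def using u by (intro node_potential_mono)
      also have "\<dots> \<le> potential n k g P S"
        unfolding potential_def F_def[symmetric] using u F0 by (intro member_le_sum) auto
      finally show ?thesis using Fpos Pair by (simp add: indicator_def)
    next
      case False
      then show ?thesis using pot Fpos Pair by simp
    qed
  qed
  then have "measure_pmf.expectation ?p (indicator {(h, S). n * (1024 * g) < total_missing n P S})
      \<le> measure_pmf.expectation ?p (\<lambda>hS. (\<lambda>(h, S). potential n k g P S) hS / F (1024 * g))"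
    using fin by (intro expectation_mono_pmf_finite)
  then have "measure_pmf.prob ?p {(h, S). n * (1024 * g) < total_missing n P S}
     \<le> measure_pmf.expectation ?p (\<lambda>(h, S). potential n k g P S) / F (1024 * g)"
    by simp
  also have "\<dots> \<le> ((1 - 1 / (512 * real (n + k))) ^ T * (n * F k) + n * F (16 * g)) / F (1024 * g)"
  proof (intro divide_right_mono)
    have "missing P S0 u \<le> k" for u
      unfolding missing_def using P card_mono[OF finP, of "P - S0 u"] by auto
    then have "potential n k g P S0 \<le> (\<Sum>u<n. F k)"
      unfolding potential_def F_def by (intro sum_mono node_potential_mono)
    then have "(1 - 1 / (512 * real (n + k))) ^ T * potential n k g P S0
        \<le> (1 - 1 / (512 * real (n + k))) ^ T * (n * F k)"
      using g by (intro mult_left_mono zero_le_power) (auto simp: divide_le_eq_1)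
    then show "measure_pmf.expectation ?p (\<lambda>(h, S). potential n k g P S)
        \<le> (1 - 1 / (512 * real (n + k))) ^ T * (n * F k) + n * F (16 * g)"
      using expected_potential_le[OF ok g P, of T] unfolding F_def by linarith
  qed (use Fpos in simp)
  finally show ?thesis by (rule order_trans[OF prob_incomplete_le[OF ok g(1)]])
qed

section \<open>Choice of the parameters\<close>

text \<open>Compares \<open>16 * g\<close> levels, of weight at most that of level
  \<open>16 * g\<close>, with the single level \<open>1024 * g\<close>, whose power factor is
  \<open>64 ^ g\<close> times larger; the cap is inactive since \<open>g \<le> n\<close>. From
  \<open>n \<le> 2 ^ g\<close>, \<open>g \<le> 2 ^ g\<close> and \<open>8 ^ g \<ge> 64\<close> one
  gets \<open>64 ^ g \<ge> 64 * n * n * g\<close>, exactly the factor required.\<close>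

lemma node_potential_ratio:
  fixes n k g :: nat
  assumes g: "2 \<le> g" "g \<le> n" "n \<le> 2 ^ g"
  shows "n * node_potential n k g (16 * g) / node_potential n k g (1024 * g) \<le> 1 / (4 * n)"
proof -
  let ?w = "weight n k g"
  have n: "0 < real n" using g by simp
  have wpos: "0 < ?w (16 * g)" using g by (simp add: weight_def)
  have "node_potential n k g (16 * g) \<le> (\<Sum>h = 1..16 * g. ?w (16 * g))"
    unfolding node_potential_def by (intro sum_mono weight_mono) auto
  then have up: "node_potential n k g (16 * g) \<le> 16 * g * ?w (16 * g)" by simp
  have w16: "?w (16 * g) = real (16 * g) ^ g * exp (real g * real (16 * g) / real (n + k))"
    using g by (simp add: weight_def)
  have "min (1024 * g) (1024 * n) = 1024 * g" "real (1024 * g) = 64 * real (16 * g)"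
    using g by auto
  then have w1024: "?w (1024 * g) = (64 * real (16 * g)) ^ g * exp (real g * real (1024 * g) / real (n + k))"
    unfolding weight_def by metis
  have "64 ^ g * ?w (16 * g) = (64 * real (16 * g)) ^ g * exp (real g * real (16 * g) / real (n + k))"
    by (simp only: w16 power_mult_distrib mult.assoc)
  also have "\<dots> \<le> ?w (1024 * g)"
    unfolding w1024 by (intro mult_left_mono) (auto intro!: divide_right_mono mult_left_mono)
  also have "\<dots> \<le> node_potential n k g (1024 * g)"
    unfolding node_potential_def using g by (intro member_le_sum) auto
  finally have low: "64 ^ g * ?w (16 * g) \<le> node_potential n k g (1024 * g)" .
  have "8 ^ 2 \<le> (8 :: nat) ^ g" using g by (intro power_increasing) auto
  moreover have "g \<le> 2 ^ g" by (simp add: less_imp_le)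
  ultimately have "8 ^ 2 * (n * n * g) \<le> 8 ^ g * ((2 ^ g * 2 ^ g) * 2 ^ g)"
    using g by (intro mult_le_mono)
  also have "\<dots> = 64 ^ g" by (simp flip: power_mult_distrib)
  finally have "real (64 * (n * n * g)) \<le> real (64 ^ g)" by (intro of_nat_mono) simp
  then have big: "64 * real n * real n * real g \<le> 64 ^ g" by simp
  have "4 * real n * (n * node_potential n k g (16 * g)) \<le> 4 * real n * (n * (16 * g * ?w (16 * g)))"
    using up by (intro mult_left_mono) auto
  also have "\<dots> = (64 * real n * real n * real g) * ?w (16 * g)" by simp
  also have "\<dots> \<le> 64 ^ g * ?w (16 * g)" using big wpos by (intro mult_right_mono) auto
  finally have "4 * real n * (n * node_potential n k g (16 * g)) \<le> node_potential n k g (1024 * g)"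
    using low by linarith
  moreover have "0 < node_potential n k g (1024 * g)"
    using low wpos by (meson less_le_trans mult_pos_pos zero_less_numeral zero_less_power)
  ultimately show ?thesis using n by (simp add: field_simps)
qed

lemma node_potential_upper:
  fixes n k g :: nat
  assumes "0 < n"
  shows "node_potential n k g k \<le> k * (real (min k (1024 * n)) ^ g * exp g)"
proof -
  have "node_potential n k g k \<le> (\<Sum>h = 1..k. weight n k g k)"
    unfolding node_potential_def by (intro sum_mono weight_mono) auto
  also have "\<dots> = k * weight n k g k" by simp
  also have "weight n k g k \<le> real (min k (1024 * n)) ^ g * exp g"
  proof -
    have "real g * real k / real (n + k) \<le> g" using assms by (simp add: field_simps)
    then show ?thesis unfolding weight_def by (intro mult_left_mono) auto
  qed
  finally show ?thesis by (simp add: mult_left_mono)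
qed

lemma node_potential_ge_1:
  assumes "0 < n" "1 \<le> x"
  shows "1 \<le> node_potential n k g x"
proof -
  have "1 \<le> weight n k g 1" using assms by (simp add: weight_def)
  also have "\<dots> = node_potential n k g 1" by (simp add: node_potential_def)
  also have "\<dots> \<le> node_potential n k g x" using assms by (intro node_potential_mono)
  finally show ?thesis .
qed

text \<open>The cap at \<open>n\<close> is harmless: no present token is lacked by all \<open>n\<close> nodes.\<close>

definition group_size :: "nat \<Rightarrow> nat \<Rightarrow> real \<Rightarrow> nat" where
  "group_size n k p = min (nat \<lceil>2 * ln (real (n * k)) / p\<rceil>) n"

context
  fixes n k :: nat and p :: real
  assumes nk: "2 \<le> n" "2 \<le> k" and p: "0 < p" "p \<le> 1"
begin

lemma ln_bounds: "1 / 2 \<le> ln (real n)" "1 / 2 \<le> ln (real k)" "ln (real (n * k)) = ln n + ln k"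
proof -
  have "ln 2 \<le> ln (real n)" "ln 2 \<le> ln (real k)" using nk by auto
  then show "1 / 2 \<le> ln (real n)" "1 / 2 \<le> ln (real k)" using ln2_ge_two_thirds by linarith+
  show "ln (real (n * k)) = ln n + ln k" using nk by (simp add: ln_mult)
qed

lemma ceiling_group:
  "2 * (ln n + ln k) \<le> 2 * (ln n + ln k) / p" "2 * (ln n + ln k) / p \<le> nat \<lceil>2 * ln (real (n * k)) / p\<rceil>"
  "nat \<lceil>2 * ln (real (n * k)) / p\<rceil> \<le> 2 * (ln n + ln k) / p + 1"
proof -
  have nn: "0 \<le> 2 * (ln n + ln k)" using ln_bounds(1,2) by argo
  then show "2 * (ln n + ln k) \<le> 2 * (ln n + ln k) / p"
    using p by (simp add: le_divide_eq mult_left_le)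
  have "0 \<le> 2 * (ln n + ln k) / p" using nn p by simp
  then show "2 * (ln n + ln k) / p \<le> nat \<lceil>2 * ln (real (n * k)) / p\<rceil>"
    "nat \<lceil>2 * ln (real (n * k)) / p\<rceil> \<le> 2 * (ln n + ln k) / p + 1"
    unfolding ln_bounds(3) by linarith+
qed

lemma group_size_bounds: "2 \<le> group_size n k p" "group_size n k p \<le> n" "n \<le> 2 ^ group_size n k p"
proof -
  define G where "G = nat \<lceil>2 * ln (real (n * k)) / p\<rceil>"
  have G: "2 * (ln n + ln k) \<le> G" unfolding G_def using ceiling_group by linarith
  then have "2 \<le> real G" using ln_bounds(1,2) by argo
  then have "2 \<le> G" by linarith
  then show "2 \<le> group_size n k p" using nk by (simp add: group_size_def G_def)
  show "group_size n k p \<le> n" by (simp add: group_size_def)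
  have "n \<le> 2 ^ G"
  proof -
    have "ln n \<le> 2 * ln n * ln 2"
      using ln_bounds ln2_ge_two_thirds by (simp add: mult_le_cancel_left1)
    also have "\<dots> \<le> G * ln 2" using G ln_bounds by (intro mult_right_mono) auto
    also have "\<dots> = ln (2 ^ G)" by (simp add: ln_realpow)
    finally have "real n \<le> 2 ^ G" using nk by simp
    then show ?thesis by (metis of_nat_le_iff of_nat_numeral of_nat_power)
  qed
  then show "n \<le> 2 ^ group_size n k p" unfolding group_size_def G_def[symmetric]
    by (simp add: min_def less_imp_le)
qed

text \<open>The first left-hand side is the logarithm of \<open>4 * n\<close> times the bound on the
  initial potential. As \<open>g\<close> is of order \<open>(ln n + ln k) / p\<close>, its product
  with \<open>m = ln (min k (1024 * n))\<close> must be bounded without squares of a logarithm: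
  \<open>m \<le> ln k\<close> serves the summand \<open>ln n\<close>, and
  \<open>m \<le> 10 + ln n \<le> 21 * ln n\<close> the summand \<open>ln k\<close>.\<close>

lemma exponent_bound:
  defines "g \<equiv> group_size n k p"
  shows "ln (4 * real n * (n * k)) + g * ln (real (min k (1024 * n))) + g \<le> 80 / p * (ln n * ln k)"
    "real g \<le> 12 / p * (ln n * ln k)"
proof -
  define a b m where "a = ln (real n)" and "b = ln (real k)" and "m = ln (real (min k (1024 * n)))"
  have ab: "1 / 2 \<le> a" "1 / 2 \<le> b" using ln_bounds by (auto simp: a_def b_def)
  have prods: "a \<le> 2 * (a * b)" "b \<le> 2 * (a * b)"
    using mult_left_mono[OF ab(2), of a] mult_right_mono[OF ab(1), of b] ab by auto
  have one: "1 \<le> 4 * (a * b)" using prods ab by linarith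
  have p1: "1 \<le> 1 / p" using p by simp
  have g: "real g \<le> 2 * (a + b) * (1 / p) + 1"
  proof -
    have "real g \<le> nat \<lceil>2 * ln (real (n * k)) / p\<rceil>" by (simp add: g_def group_size_def)
    also have "\<dots> \<le> 2 * (a + b) / p + 1" unfolding a_def b_def by (rule ceiling_group)
    finally show ?thesis by simp
  qed
  have e1: "2 * (a + b) * (1 / p) \<le> 8 * (a * b) * (1 / p)"
    using prods p by (intro mult_right_mono) auto
  have e2: "4 * (a * b) * 1 \<le> 4 * (a * b) * (1 / p)"
    using p1 ab by (intro mult_left_mono) auto
  show g12: "real g \<le> 12 / p * (ln n * ln k)"
  proof -
    have "real g \<le> 12 * ((a * b) * (1 / p))" using g e1 e2 one by argo
    then show ?thesis unfolding a_def[symmetric] b_def[symmetric] by simp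
  qed
  have m0: "0 \<le> m" using nk by (auto simp: m_def min_def)
  have mb: "m \<le> b" unfolding m_def b_def using nk by (intro ln_mono) auto
  have "m \<le> ln (2 ^ 10 * real n)" unfolding m_def using nk by (intro ln_mono) auto
  also have "\<dots> = 10 * ln 2 + a" using nk ln_realpow[of 2 10] by (simp add: ln_mult a_def)
  also have "\<dots> \<le> 10 + a" using ln_le_minus_one[of 2] by simp
  finally have ma: "m \<le> 21 * a" using ab by linarith
  have "b * m \<le> b * (21 * a)" using ma ab by (intro mult_left_mono) auto
  then have bm: "b * m \<le> 21 * (a * b)" by (simp only: mult_ac)
  have am: "a * m \<le> a * b" using mb ab by (intro mult_left_mono) auto
  have "real g * m \<le> (2 * (a + b) * (1 / p) + 1) * m" using g m0 by (rule mult_right_mono)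
  also have "\<dots> = 2 * (a * m + b * m) * (1 / p) + m" by (simp add: algebra_simps)
  also have "\<dots> \<le> 2 * (22 * (a * b)) * (1 / p) + 2 * (a * b) * (1 / p)"
  proof (intro add_mono mult_right_mono)
    show "2 * (a * m + b * m) \<le> 2 * (22 * (a * b))" using am bm by argo
    have "2 * (a * b) * 1 \<le> 2 * (a * b) * (1 / p)" using p1 ab by (intro mult_left_mono) auto
    then show "m \<le> 2 * (a * b) * (1 / p)" using mb prods by linarith
  qed (use p in auto)
  finally have gm: "real g * m \<le> 46 * (a * b) * (1 / p)" by simp
  have "ln (4 * real n * (n * k)) = 2 * ln 2 + 2 * a + b"
  proof -
    have "ln (4 :: real) = 2 * ln 2" using ln_realpow[of 2 2] by simp
    then show ?thesis using nk by (simp add: ln_mult a_def b_def)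
  qed
  also have "\<dots> \<le> 14 * (a * b)" using prods one ln_le_minus_one[of 2] by simp
  finally show "ln (4 * real n * (n * k)) + g * ln (real (min k (1024 * n))) + g \<le> 80 / p * (ln n * ln k)"
    using gm g12 p1 ab unfolding a_def[symmetric] b_def[symmetric] m_def[symmetric]
    using mult_left_mono[OF p1, of "14 * (a * b)"] by (simp add: field_simps)
qed

text \<open>The last \<open>n * (1024 * g)\<close> rounds are reserved for the final phase, the
  first \<open>T1\<close> for the drift. Their costs \<open>1024 * 12\<close> and
  \<open>512 * 80\<close>, in units of \<open>(n + k) * ln n * ln k / p\<close>, add up to less than
  60000. The decayed initial potential and the additive term of the drift then contribute at most
  \<open>1 / (4 * n)\<close> each.\<close>

lemma prob_spread_failure:
  assumes ok: "mixed_state n (group_size n k p) P S0" "valid_adversary n adv" "card P \<le> k"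
    and T: "60000 / p * real (n + k) * ln n * ln k \<le> real T"
  shows "measure_pmf.prob (sym_diff_exec adv S0 T) {(h, S). total_missing n P S \<noteq> 0} \<le> 1 / (2 * n)"
proof -
  define g where "g = group_size n k p"
  define L where "L = ln (real n) * ln (real k)"
  define b where "b = 1 / (512 * real (n + k))"
  note g = group_size_bounds[folded g_def]
  have L0: "0 \<le> L" unfolding L_def using ln_bounds by (intro mult_nonneg_nonneg) auto
  have T': "60000 / p * real (n + k) * L \<le> real T" using T by (simp add: L_def mult_ac)
  have B: "real (n * (1024 * g)) \<le> 12288 / p * real (n + k) * L"
  proof -
    have "real (n * (1024 * g)) = real n * (1024 * real g)" by simp
    also have "\<dots> \<le> real n * (1024 * (12 / p * L))"
      using exponent_bound(2) unfolding g_def L_def by (intro mult_left_mono) auto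
    also have "\<dots> \<le> real (n + k) * (1024 * (12 / p * L))"
      using L0 p by (intro mult_right_mono) auto
    finally show ?thesis by (simp add: mult_ac)
  qed
  moreover have "12288 / p * real (n + k) * L + 512 * 80 / p * real (n + k) * L \<le> 60000 / p * real (n + k) * L"
  proof -
    have "0 \<le> r / p" if "0 \<le> r" for r using that p by simp
    moreover have "c / p * r * L = c * (r * L / p)" for c r by simp
    moreover have "0 \<le> real (n + k) * L" using L0 by simp
    ultimately have "0 \<le> real (n + k) * L / p" by blast
    then show ?thesis unfolding \<open>\<And>c r. c / p * r * L = c * (r * L / p)\<close> by argo
  qed
  ultimately have sum: "real (n * (1024 * g)) + 512 * 80 / p * real (n + k) * L \<le> T"
    using T' by linarith
  moreover have "0 \<le> 512 * 80 / p * real (n + k) * L" using L0 p by simp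
  ultimately have "n * (1024 * g) \<le> T" by linarith
  then obtain T1 where T1: "T = T1 + n * (1024 * g)" by (metis add.commute le_Suc_ex)
  then have "512 * 80 / p * real (n + k) * L \<le> T1" using sum by simp
  then have "80 / p * L \<le> b * T1" using nk p by (simp add: b_def field_simps)
  then have ex: "ln (4 * real n * (n * k)) + g * ln (real (min k (1024 * n))) + g \<le> b * T1"
    using exponent_bound(1) unfolding g_def L_def by linarith
  have m: "0 < real (min k (1024 * n))" using nk by auto
  have "(1 - b) ^ T1 \<le> exp (- b) ^ T1"
    using exp_ge_add_one_self[of "- b"] nk by (intro power_mono) (auto simp: b_def divide_le_eq_1)
  also have "\<dots> = exp (- (b * T1))" by (simp add: mult.commute flip: exp_of_nat_mult)
  finally have "4 * real n * ((1 - b) ^ T1 * (n * node_potential n k g k))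
      \<le> 4 * real n * (exp (- (b * T1)) * (n * (k * (real (min k (1024 * n)) ^ g * exp g))))"
    using node_potential_upper[of n k g] nk node_potential_ge_1[of n k k g]
    by (intro mult_left_mono mult_mono) auto
  also have "\<dots> = exp (- (b * T1)) * exp (ln (4 * real n * (n * k)) + g * ln (real (min k (1024 * n))) + g)"
    using nk m by (simp add: exp_add exp_of_nat_mult)
  also have "\<dots> \<le> 1" unfolding exp_add[symmetric] using ex by simp
  finally have "(1 - b) ^ T1 * (n * node_potential n k g k) \<le> 1 / (4 * n)"
    using nk by (simp add: field_simps)
  moreover have "1 \<le> node_potential n k g (1024 * g)" using nk g by (intro node_potential_ge_1) auto
  moreover have "0 \<le> (1 - b) ^ T1 * (n * node_potential n k g k)"
    using nk node_potential_ge_1[of n k k g]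
    by (intro mult_nonneg_nonneg zero_le_power) (auto simp: b_def divide_le_eq_1)
  ultimately have "(1 - b) ^ T1 * (n * node_potential n k g k) / node_potential n k g (1024 * g)
      \<le> 1 / (4 * n) / 1"
    by (intro frac_le) auto
  moreover have "n * node_potential n k g (16 * g) / node_potential n k g (1024 * g) \<le> 1 / (4 * n)"
    using g by (intro node_potential_ratio)
  moreover have "measure_pmf.prob (sym_diff_exec adv S0 T) {(h, S). total_missing n P S \<noteq> 0}
    \<le> ((1 - b) ^ T1 * (n * node_potential n k g k) + n * node_potential n k g (16 * g))
      / node_potential n k g (1024 * g)"
    unfolding T1 b_def using ok g by (intro prob_not_spread_le) (auto simp: g_def)
  moreover have "1 / (4 * real n) + 1 / (4 * real n) = 1 / (2 * real n)" by simp
  ultimately show ?thesis unfolding add_divide_distrib by linarith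
qed

end

section \<open>Random initial configurations\<close>

text \<open>Serves both extremes: \<open>v = False\<close> for rectangles of missing tokens,
  \<open>v = True\<close> for the event that every node starts with every token.\<close>

lemma prob_random_config_const:
  assumes p: "0 \<le> p" "p \<le> 1" and A: "A \<subseteq> {..<n} \<times> {..<k}"
  shows "measure_pmf.prob (random_config n k p) {S. \<forall>(u, t)\<in>A. (t \<in> S u) = v}
    = (if v then p else 1 - p) ^ card A"
proof -
  let ?I = "{..<n} \<times> {..<k}"
  define B where "B x = (if x \<in> A then {v} else UNIV)" for x
  have fin: "finite A" using A finite_subset by blast
  have "(\<lambda>b u. {t. b (u, t)}) -` {S. \<forall>(u, t)\<in>A. (t \<in> S u) = v} = Pi ?I B"
    using A by (auto simp: B_def Pi_def)
  then have "measure_pmf.prob (random_config n k p) {S. \<forall>(u, t)\<in>A. (t \<in> S u) = v}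
      = measure_pmf.prob (Pi_pmf ?I False (\<lambda>_. bernoulli_pmf p)) (Pi ?I B)"
    by (simp add: random_config_def)
  also have "\<dots> = (\<Prod>x\<in>?I. measure_pmf.prob (bernoulli_pmf p) (B x))"
    by (rule measure_Pi_pmf_Pi) simp
  also have "\<dots> = (\<Prod>x\<in>?I. if x \<in> A then pmf (bernoulli_pmf p) v else 1)"
    by (intro prod.cong) (auto simp: B_def measure_pmf_single)
  also have "\<dots> = (\<Prod>x\<in>A. pmf (bernoulli_pmf p) v)"
    using A by (subst prod.inter_restrict[symmetric]) (auto simp: Int_absorb1)
  also have "\<dots> = (if v then p else 1 - p) ^ card A" using p by simp
  finally show ?thesis .
qed

lemma random_config_support:
  assumes "S0 \<in> set_pmf (random_config n k p)"
  shows "S0 u \<subseteq> {..<k}"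
proof -
  obtain b where b: "b \<in> set_pmf (Pi_pmf ({..<n} \<times> {..<k}) False (\<lambda>_. bernoulli_pmf p))"
    "S0 = (\<lambda>u. {t. b (u, t)})"
    using assms by (auto simp: random_config_def)
  then have "\<not> b (u, t)" if "t \<notin> {..<k}" for t
    using set_Pi_pmf_subset[of "{..<n} \<times> {..<k}" False "\<lambda>_. bernoulli_pmf p"] that by auto
  then show ?thesis using b(2) by auto
qed

text \<open>Lacking refers to all \<open>k\<close> tokens here, so that the event speaks of
  independent entries. The case \<open>g = n\<close> is excluded: absent tokens may make it likely,
  but no token that is present is lacked by all nodes.\<close>

definition ill_mixed :: "nat \<Rightarrow> nat \<Rightarrow> nat \<Rightarrow> config set" where
  "ill_mixed n k g = {S0. g < n \<and> (\<exists>W\<subseteq>{..<n}. card W = g \<and> g \<le> card (\<Inter>w\<in>W. {..<k} - S0 w))}"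

lemma mixed_state_initial:
  assumes S0: "\<And>u. u < n \<Longrightarrow> S0 u \<subseteq> {..<k}" and mixed: "S0 \<notin> ill_mixed n k g" and g: "0 < g" "g \<le> n"
  shows "mixed_state n g (\<Union>u<n. S0 u) S0"
proof -
  have "card (\<Inter>w\<in>W. (\<Union>u<n. S0 u) - S0 w) < g" if W: "W \<subseteq> {..<n}" "card W = g" for W
  proof (cases "g < n")
    case True
    have "W \<noteq> {}" using W g by auto
    then have "finite (\<Inter>w\<in>W. {..<k} - S0 w)" by auto
    then have "card (\<Inter>w\<in>W. (\<Union>u<n. S0 u) - S0 w) \<le> card (\<Inter>w\<in>W. {..<k} - S0 w)"
    proof (rule card_mono)
      have "(\<Union>u<n. S0 u) \<subseteq> {..<k}" using S0 by auto
      then show "(\<Inter>w\<in>W. (\<Union>u<n. S0 u) - S0 w) \<subseteq> (\<Inter>w\<in>W. {..<k} - S0 w)"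
        by (intro INF_mono) blast
    qed
    also have "\<dots> < g"
    proof (rule ccontr)
      assume "\<not> ?thesis"
      then have "g \<le> card (\<Inter>w\<in>W. {..<k} - S0 w)" by simp
      then show False using mixed True W unfolding ill_mixed_def by blast
    qed
    finally show ?thesis .
  next
    case False
    then have Wn: "W = {..<n}" using W g by (intro card_subset_eq) auto
    have "t \<notin> (\<Inter>w\<in>W. (\<Union>u<n. S0 u) - S0 w)" for t
    proof
      assume t: "t \<in> (\<Inter>w\<in>W. (\<Union>u<n. S0 u) - S0 w)"
      have "0 \<in> W" using g Wn by simp
      then have "t \<in> (\<Union>u<n. S0 u)" using t by blast
      then obtain v where "v \<in> W" "t \<in> S0 v" using Wn by blast
      then show False using t by blast
    qed
    then have "(\<Inter>w\<in>W. (\<Union>u<n. S0 u) - S0 w) = {}" by blast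
    then show ?thesis using g by (metis card.empty)
  qed
  moreover have "finite (\<Union>u<n. S0 u)"
    by (rule finite_subset[of _ "{..<k}"]) (use S0 in auto)
  ultimately show ?thesis unfolding mixed_state_def by blast
qed

text \<open>Union bound over all \<open>g\<close> by \<open>g\<close> rectangles of missing entries:
  at most \<open>(n * k * exp (- (p * g))) ^ g\<close>, and
  \<open>p * g \<ge> 2 * ln (n * k)\<close> makes this at most \<open>(1 / (n * k)) ^ g\<close>.
  Then \<open>g \<ge> 1\<close> and \<open>k \<ge> 2\<close> give the claim.\<close>

lemma prob_ill_mixed:
  assumes nk: "2 \<le> n" "2 \<le> k" and p: "0 < p" "p \<le> 1"
  shows "measure_pmf.prob (random_config n k p) (ill_mixed n k (group_size n k p)) \<le> 1 / (2 * n)"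
proof (cases "group_size n k p < n")
  case False
  then have "ill_mixed n k (group_size n k p) = {}" by (auto simp: ill_mixed_def)
  then show ?thesis by simp
next
  case True
  define g where "g = group_size n k p"
  have gn: "g \<le> n" "2 \<le> g" using group_size_bounds[OF nk p] by (auto simp: g_def)
  let ?M = "random_config n k p"
  define K where "K = {W. W \<subseteq> {..<n} \<and> card W = g} \<times> {Y. Y \<subseteq> {..<k} \<and> card Y = g}"
  define Q where "Q WY = {S0 :: config. \<forall>(u, t)\<in>fst WY \<times> snd WY. (t \<in> S0 u) = False}" for WY
  have finK: "finite K" unfolding K_def by simp
  have "ill_mixed n k g \<subseteq> (\<Union>WY\<in>K. Q WY)"
  proof
    fix S0 assume "S0 \<in> ill_mixed n k g"
    then obtain W where W: "W \<subseteq> {..<n}" "card W = g" "g \<le> card (\<Inter>w\<in>W. {..<k} - S0 w)"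
      by (auto simp: ill_mixed_def)
    from W(3) obtain Y where Y: "Y \<subseteq> (\<Inter>w\<in>W. {..<k} - S0 w)" "card Y = g"
      by (meson obtain_subset_with_card_n)
    have "W \<noteq> {}" using W gn by auto
    then have "Y \<subseteq> {..<k}" using Y by blast
    then have "(W, Y) \<in> K" using W Y by (simp add: K_def)
    moreover have "Y \<subseteq> {..<k} - S0 w" if "w \<in> W" for w using Y(1) that by blast
    then have "S0 \<in> Q (W, Y)" by (auto simp: Q_def)
    ultimately show "S0 \<in> (\<Union>WY\<in>K. Q WY)" by blast
  qed
  then have "measure_pmf.prob ?M (ill_mixed n k g) \<le> measure_pmf.prob ?M (\<Union>WY\<in>K. Q WY)"
    by (intro measure_pmf.finite_measure_mono) auto
  also have "\<dots> \<le> (\<Sum>WY\<in>K. measure_pmf.prob ?M (Q WY))"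
    using finK by (intro measure_pmf.finite_measure_subadditive_finite) auto
  also have "\<dots> = (\<Sum>WY\<in>K. (1 - p) ^ (g * g))"
  proof (intro sum.cong refl)
    fix WY assume "WY \<in> K"
    then have "fst WY \<times> snd WY \<subseteq> {..<n} \<times> {..<k}" "card (fst WY \<times> snd WY) = g * g"
      by (auto simp: K_def card_cartesian_product)
    then show "measure_pmf.prob ?M (Q WY) = (1 - p) ^ (g * g)"
      using prob_random_config_const[of p "fst WY \<times> snd WY" n k False] p by (simp add: Q_def)
  qed
  also have "\<dots> = real (n choose g) * real (k choose g) * (1 - p) ^ (g * g)"
    by (simp add: K_def card_cartesian_product n_subsets)
  also have "\<dots> \<le> real (n ^ g) * real (k ^ g) * (exp (- p) ^ g) ^ g"
  proof -
    have "m choose g \<le> m ^ g" for m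
      by (cases "g \<le> m") (auto simp: binomial_le_pow binomial_eq_0)
    moreover have "(1 - p) ^ (g * g) \<le> (exp (- p) ^ g) ^ g"
      unfolding power_mult using p exp_ge_add_one_self[of "- p"] by (intro power_mono) auto
    ultimately show ?thesis using p by (intro mult_mono of_nat_mono) auto
  qed
  also have "\<dots> = (real (n * k) * exp (- (p * g))) ^ g"
    by (simp add: power_mult_distrib mult.commute flip: exp_of_nat_mult)
  also have "\<dots> \<le> (1 / real (n * k)) ^ g"
  proof (intro power_mono)
    define G where "G = nat \<lceil>2 * ln (real (n * k)) / p\<rceil>"
    have "g = G" using True by (simp add: g_def group_size_def G_def)
    then have "2 * (ln n + ln k) / p \<le> g" using ceiling_group[OF nk p] by (simp add: G_def)
    then have "2 * ln (real (n * k)) \<le> p * g"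
      using p ln_bounds[OF nk p] by (simp add: divide_le_eq mult.commute)
    then have "exp (- (p * g)) \<le> exp (- (2 * ln (real (n * k))))" by simp
    also have "\<dots> = 1 / (real (n * k) * real (n * k))"
      using nk by (simp add: exp_minus exp_double power2_eq_square inverse_eq_divide)
    finally have "real (n * k) * exp (- (p * g)) \<le> real (n * k) * (1 / (real (n * k) * real (n * k)))"
      by (intro mult_left_mono) auto
    then show "real (n * k) * exp (- (p * g)) \<le> 1 / real (n * k)" using nk by simp
  qed simp
  also have "\<dots> \<le> (1 / real (n * k)) ^ 1"
  proof (intro power_decreasing)
    have "1 \<le> n * k" using nk by simp
    then have "1 \<le> real (n * k)" by linarith
    then show "1 / real (n * k) \<le> 1" by simp
  qed (use gn in auto)
  also have "\<dots> \<le> 1 / (2 * n)"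
  proof -
    have "real (2 * n) \<le> real (n * k)" using nk by (intro of_nat_mono) simp
    then show ?thesis using nk by (simp add: frac_le)
  qed
  finally show ?thesis by (simp add: g_def)
qed

lemma prob_bind_pmf:
  "measure_pmf.prob (bind_pmf M f) A = measure_pmf.expectation M (\<lambda>x. measure_pmf.prob (f x) A)"
proof -
  have int: "integrable M (\<lambda>x. measure_pmf.prob (f x) A)"
    by (rule measure_pmf.integrable_const_bound[where B = 1]) auto
  have "ennreal (measure_pmf.prob (bind_pmf M f) A) = (\<integral>\<^sup>+x. ennreal (measure_pmf.prob (f x) A) \<partial>M)"
    by (simp flip: measure_pmf.emeasure_eq_measure)
  also have "\<dots> = ennreal (measure_pmf.expectation M (\<lambda>x. measure_pmf.prob (f x) A))"
    by (rule nn_integral_eq_integral[OF int]) simp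
  finally show ?thesis by (simp add: integral_nonneg_AE)
qed

lemma prob_bind_pmf_ge:
  assumes "0 \<le> q" "\<And>x. x \<in> set_pmf M \<Longrightarrow> x \<in> G \<Longrightarrow> q \<le> measure_pmf.prob (f x) A"
  shows "q * measure_pmf.prob M G \<le> measure_pmf.prob (bind_pmf M f) A"
proof -
  have "q * measure_pmf.prob M G = measure_pmf.expectation M (\<lambda>x. q * indicator G x)" by simp
  also have "\<dots> \<le> measure_pmf.expectation M (\<lambda>x. measure_pmf.prob (f x) A)"
  proof (rule integral_mono_AE)
    show "integrable M (\<lambda>x. measure_pmf.prob (f x) A)"
      by (rule measure_pmf.integrable_const_bound[where B = 1]) auto
    show "AE x in M. q * indicator G x \<le> measure_pmf.prob (f x) A"
      using assms by (auto simp: AE_measure_pmf_iff indicator_def)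
    show "integrable M (\<lambda>x. q * indicator G x)"
      by (intro integrable_mult_right measure_pmf.integrable_const_bound[where B = 1]) auto
  qed
  finally show ?thesis by (simp add: prob_bind_pmf)
qed

lemma exec_mono: "(h, S) \<in> set_pmf (sym_diff_exec adv S0 T) \<Longrightarrow> S0 u \<subseteq> S u"
proof (induction T arbitrary: h S)
  case (Suc T)
  then obtain h' S' c where "(h', S') \<in> set_pmf (sym_diff_exec adv S0 T)" "S = deliver S' (adv h' S') c"
    by (auto simp: Let_def)
  then show ?case using Suc.IH deliver_superset[of S' u] by fastforce
qed simp

section \<open>Success probability of the whole run\<close>

context
  fixes n k :: nat and p :: real and adv :: adversary and T :: nat
  assumes nk: "2 \<le> n" "2 \<le> k" and p: "0 < p" "p \<le> 1" and adv: "valid_adversary n adv"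
    and T: "60000 / p * real (n + k) * ln n * ln k \<le> real T"
begin

lemma prob_disseminated_from:
  assumes S0: "S0 \<in> set_pmf (random_config n k p)" "S0 \<notin> ill_mixed n k (group_size n k p)"
  shows "1 - 1 / (2 * n) \<le> measure_pmf.prob (sym_diff_exec adv S0 T) {(h, S). all_disseminated n S0 S}"
proof -
  let ?P = "\<Union>u<n. S0 u"
  have sub: "S0 u \<subseteq> {..<k}" for u using random_config_support[OF S0(1)] .
  have ok: "mixed_state n (group_size n k p) ?P S0"
    using sub S0(2) group_size_bounds[OF nk p] by (intro mixed_state_initial) auto
  have finP: "finite ?P" using ok by (simp add: mixed_state_def)
  have "card ?P \<le> card {..<k}" using sub by (intro card_mono) auto
  then have "measure_pmf.prob (sym_diff_exec adv S0 T) {(h, S). total_missing n ?P S \<noteq> 0} \<le> 1 / (2 * n)"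
    using T by (intro prob_spread_failure[OF nk p ok adv]) auto
  then have "1 - 1 / (2 * n) \<le> measure_pmf.prob (sym_diff_exec adv S0 T)
      (UNIV - {(h, S). total_missing n ?P S \<noteq> 0})"
    using measure_pmf.prob_compl[of "{(h, S). total_missing n ?P S \<noteq> 0}" "sym_diff_exec adv S0 T"]
    by simp
  also have "\<dots> \<le> measure_pmf.prob (sym_diff_exec adv S0 T) {(h, S). all_disseminated n S0 S}"
  proof (intro measure_pmf.finite_measure_mono subsetI)
    fix hS :: "history \<times> config" assume "hS \<in> UNIV - {(h, S). total_missing n ?P S \<noteq> 0}"
    then obtain h S where hS: "hS = (h, S)" "total_missing n ?P S = 0" by (cases hS) auto
    then have "?P \<subseteq> S u" if "u < n" for u
      using that finP by (auto simp: total_missing_def missing_def)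
    then have "all_disseminated n S0 S" unfolding all_disseminated_def by blast
    then show "hS \<in> {(h, S). all_disseminated n S0 S}" using hS(1) by simp
  qed simp
  finally show ?thesis .
qed

lemma prob_run:
  "measure_pmf.prob (map_pmf (\<lambda>(h, S). (S0, S)) (sym_diff_exec adv S0 T)) {(S0, S). Q S0 S}
    = measure_pmf.prob (sym_diff_exec adv S0 T) {(h, S). Q S0 S}"
  unfolding measure_map_pmf by (rule arg_cong[where f = "measure_pmf.prob _"]) auto

text \<open>The start fails to be well mixed with probability at most \<open>1 / (2 * n)\<close>,
  and from a well-mixed start the execution fails with probability at most
  \<open>1 / (2 * n)\<close>.\<close>

lemma prob_run_disseminated:
  "1 - 1 / n \<le> measure_pmf.prob (sym_diff_run n k p adv T) {(S0, S). all_disseminated n S0 S}"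
proof -
  let ?M = "random_config n k p" and ?I = "ill_mixed n k (group_size n k p)"
  have n: "0 \<le> 1 - 1 / real (2 * n)" using nk by simp
  have "1 - 1 / (2 * n) \<le> measure_pmf.prob ?M (- ?I)"
    using prob_ill_mixed[OF nk p] measure_pmf.prob_compl[of ?I ?M] by (simp add: Compl_eq_Diff_UNIV)
  then have "(1 - 1 / (2 * n)) * (1 - 1 / (2 * n)) \<le> (1 - 1 / (2 * n)) * measure_pmf.prob ?M (- ?I)"
    using n by (intro mult_left_mono) auto
  also have "\<dots> \<le> measure_pmf.prob (sym_diff_run n k p adv T) {(S0, S). all_disseminated n S0 S}"
    unfolding sym_diff_run_def
  proof (rule prob_bind_pmf_ge[OF n])
    fix S0 assume "S0 \<in> set_pmf ?M" "S0 \<in> - ?I"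
    then show "1 - 1 / (2 * n) \<le> measure_pmf.prob (map_pmf (\<lambda>(h, S). (S0, S)) (sym_diff_exec adv S0 T))
        {(S0, S). all_disseminated n S0 S}"
      unfolding prob_run using prob_disseminated_from by simp
  qed
  finally have "(1 - 1 / (2 * n)) * (1 - 1 / (2 * n)) \<le>
    measure_pmf.prob (sym_diff_run n k p adv T) {(S0, S). all_disseminated n S0 S}" .
  moreover have "1 - 1 / n \<le> (1 - 1 / real (2 * n)) * (1 - 1 / real (2 * n))"
    using nk by (simp add: field_simps)
  ultimately show ?thesis by (rule order_trans[rotated])
qed

lemma gossip_complete_if:
  assumes "tokens_present n k S0" "all_disseminated n S0 S"
  shows "gossip_complete n k S"
  using assms unfolding tokens_present_def all_disseminated_def gossip_complete_def by blast

text \<open>Union bound on the joint law, whose first marginal is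
  \<open>random_config n k p\<close>: presence concerns the initial configuration, dissemination the
  pair.\<close>

lemma prob_run_complete:
  assumes "1 - d \<le> measure_pmf.prob (random_config n k p) {S0. tokens_present n k S0}"
  shows "1 - (d + 1 / n) \<le> measure_pmf.prob (sym_diff_run n k p adv T) {(S0, S). gossip_complete n k S}"
proof -
  let ?R = "sym_diff_run n k p adv T"
  let ?D = "{(S0, S). all_disseminated n S0 S}" and ?H = "{(S0 :: config, S :: config). tokens_present n k S0}"
  have "map_pmf fst ?R = random_config n k p"
    by (simp add: sym_diff_run_def map_bind_pmf map_pmf_comp case_prod_unfold bind_return_pmf')
  then have "measure_pmf.prob (random_config n k p) {S0. tokens_present n k S0} =
      measure_pmf.prob ?R (fst -` {S0. tokens_present n k S0})"
    by (metis measure_map_pmf)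
  also have "fst -` {S0. tokens_present n k S0} = ?H" by auto
  finally have H: "1 - d \<le> measure_pmf.prob ?R ?H" using assms by simp
  have "measure_pmf.prob ?R ?H + measure_pmf.prob ?R ?D \<le> 1 + measure_pmf.prob ?R (?H \<inter> ?D)"
    using measure_Un3[of ?H "measure_pmf ?R" ?D] measure_pmf.prob_le_1[of ?R "?H \<union> ?D"]
    by (simp add: measure_pmf.finite_measure_Union' measure_pmf.finite_measure_Diff' Int_commute)
  moreover have "measure_pmf.prob ?R (?H \<inter> ?D) \<le> measure_pmf.prob ?R {(S0, S). gossip_complete n k S}"
    using gossip_complete_if by (intro measure_pmf.finite_measure_mono) auto
  ultimately show ?thesis using H prob_run_disseminated by linarith
qed

text \<open>For bounded \<open>n\<close> the sum of the two failure probabilities may exceed \<open>1\<close>. If the group size is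
  \<open>n\<close>, then every initial configuration is well mixed, so absent tokens are the only obstacle from the
  start; otherwise \<open>k\<close> is bounded too, and all nodes hold all tokens with constant probability.\<close>

lemma prob_run_complete_small:
  assumes present: "d \<le> measure_pmf.prob (random_config n k p) {S0. tokens_present n k S0}"
    and small: "real n \<le> N"
  shows "min (d / 2) (p ^ nat \<lceil>exp N\<rceil>) \<le>
    measure_pmf.prob (sym_diff_run n k p adv T) {(S0, S). gossip_complete n k S}"
proof (cases "group_size n k p < n")
  case False
  then have no: "ill_mixed n k (group_size n k p) = {}" by (auto simp: ill_mixed_def)
  have "1 / 2 * measure_pmf.prob (random_config n k p) {S0. tokens_present n k S0}
      \<le> measure_pmf.prob (sym_diff_run n k p adv T) {(S0, S). gossip_complete n k S}"
    unfolding sym_diff_run_def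
  proof (rule prob_bind_pmf_ge)
    fix S0 assume S0: "S0 \<in> set_pmf (random_config n k p)" "S0 \<in> {S0. tokens_present n k S0}"
    have "1 / 2 \<le> 1 - 1 / (2 * real n)" using nk by (simp add: field_simps)
    also have "\<dots> \<le> measure_pmf.prob (sym_diff_exec adv S0 T) {(h, S). all_disseminated n S0 S}"
      using prob_disseminated_from[OF S0(1)] no by simp
    also have "\<dots> \<le> measure_pmf.prob (sym_diff_exec adv S0 T) {(h, S). gossip_complete n k S}"
      using S0(2) gossip_complete_if by (intro measure_pmf.finite_measure_mono) auto
    finally show "1 / 2 \<le> measure_pmf.prob (map_pmf (\<lambda>(h, S). (S0, S)) (sym_diff_exec adv S0 T))
        {(S0, S). gossip_complete n k S}"
      by (simp only: prob_run)
  qed simp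
  then show ?thesis using present by linarith
next
  case True
  \<comment> \<open>The minimum in \<open>group_size\<close> is attained by the ceiling, which is
    therefore below \<open>n\<close>; this bounds \<open>ln (n * k)\<close> and hence
    \<open>n * k\<close> in terms of \<open>N\<close>.\<close>
  have "2 * (ln n + ln k) \<le> n"
    using True ceiling_group[OF nk p] unfolding group_size_def by linarith
  then have "ln (real (n * k)) \<le> N" using small ln_bounds[OF nk p] by argo
  moreover have "real (n * k) = exp (ln (real (n * k)))" using nk by simp
  ultimately have "real (n * k) \<le> exp N" by (metis exp_le_cancel_iff)
  then have nkN: "n * k \<le> nat \<lceil>exp N\<rceil>" by linarith
  let ?I = "{..<n} \<times> {..<k}"
  have "p ^ nat \<lceil>exp N\<rceil> \<le> p ^ (n * k)" using nkN p by (intro power_decreasing) auto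
  also have "\<dots> = 1 * measure_pmf.prob (random_config n k p) {S. \<forall>(u, t)\<in>?I. (t \<in> S u) = True}"
    using prob_random_config_const[of p ?I n k True] p by (simp add: card_cartesian_product)
  also have "\<dots> \<le> measure_pmf.prob (sym_diff_run n k p adv T) {(S0, S). gossip_complete n k S}"
    unfolding sym_diff_run_def
  proof (rule prob_bind_pmf_ge)
    fix S0 :: config assume S0: "S0 \<in> {S. \<forall>(u, t)\<in>?I. (t \<in> S u) = True}"
    \<comment> \<open>Starting complete, the execution stays complete, as no token is lost.\<close>
    have "measure_pmf.prob (sym_diff_exec adv S0 T) {(h, S). gossip_complete n k S} = 1"
    proof (subst measure_pmf.prob_eq_1, simp, subst AE_measure_pmf_iff, intro ballI)
      fix hS :: "history \<times> config" assume hS: "hS \<in> set_pmf (sym_diff_exec adv S0 T)"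
      obtain h S where "hS = (h, S)" by (cases hS)
      then show "hS \<in> {(h, S). gossip_complete n k S}"
        using hS S0 exec_mono[of h S adv S0 T] by (auto simp: gossip_complete_def)
    qed
    then show "1 \<le> measure_pmf.prob (map_pmf (\<lambda>(h, S). (S0, S)) (sym_diff_exec adv S0 T))
        {(S0, S). gossip_complete n k S}"
      by (simp only: prob_run)
  qed simp
  finally show ?thesis by linarith
qed

end

text \<open>Above \<open>N\<close> the two error terms are together at most
  \<open>2 * n powr - c\<close> with \<open>c = min b 1\<close>, and \<open>N\<close> is where
  \<open>n powr (c / 2)\<close> reaches 2 and absorbs the factor. Up to \<open>N\<close> a small
  \<open>a\<close> makes \<open>1 - n powr - a\<close> at most \<open>eta\<close>. \<open>N\<close>
  is fixed before \<open>eta\<close> because the constant success probability available for bounded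
  \<open>n\<close> depends on \<open>N\<close>.\<close>

lemma powr_absorbs_small_cases:
  fixes b :: real
  assumes b: "0 < b"
  obtains N where "\<And>eta. 0 < eta \<Longrightarrow> eta < 1 \<Longrightarrow>
    \<exists>a>0. \<forall>n\<ge>2. \<forall>q :: real. 1 - (real n powr - b + 1 / n) \<le> q \<longrightarrow> (real n \<le> N \<longrightarrow> eta \<le> q)
      \<longrightarrow> 1 - real n powr - a \<le> q"
proof
  define c where "c = min b 1"
  define N where "N = 2 powr (2 / c)"
  have c: "0 < c" "c \<le> b" "c \<le> 1" using b by (auto simp: c_def)
  have N1: "1 < N" unfolding N_def using c by (intro gr_one_powr) auto
  fix eta :: real assume eta: "0 < eta" "eta < 1"
  define a where "a = min (c / 2) (- ln (1 - eta) / ln N)"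
  have lnN: "0 < ln N" using N1 by simp
  have "ln (1 - eta) < 0" using eta by (intro ln_less_zero) auto
  then have a: "0 < a" using c lnN by (auto simp: a_def divide_neg_pos)
  show "\<exists>a>0. \<forall>n\<ge>2. \<forall>q :: real. 1 - (real n powr - b + 1 / n) \<le> q \<longrightarrow>
      (real n \<le> 2 powr (2 / min b 1) \<longrightarrow> eta \<le> q) \<longrightarrow> 1 - real n powr - a \<le> q"
  proof (intro exI[of _ a] conjI a allI impI)
    fix n :: nat and q :: real
    assume n: "2 \<le> n" and q: "1 - (real n powr - b + 1 / n) \<le> q"
      "real n \<le> 2 powr (2 / min b 1) \<longrightarrow> eta \<le> q"
    have n1: "1 \<le> real n" using n by simp
    show "1 - real n powr - a \<le> q"
    proof (cases "real n \<le> N")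
      case True
      have "a * ln (real n) \<le> a * ln N" using True a n by (intro mult_left_mono ln_mono) auto
      also have "\<dots> \<le> - ln (1 - eta) / ln N * ln N"
        using lnN by (intro mult_right_mono) (auto simp: a_def)
      also have "\<dots> = - ln (1 - eta)" using lnN by simp
      finally have "exp (ln (1 - eta)) \<le> exp (- a * ln (real n))" by simp
      then have "1 - eta \<le> real n powr - a" using eta n by (simp add: powr_def)
      then show ?thesis using q(2) True by (simp add: N_def c_def)
    next
      case False
      have "2 = N powr (c / 2)" using c by (simp add: N_def powr_powr)
      also have "\<dots> \<le> real n powr (c / 2)" using False N1 c by (intro powr_mono2) auto
      finally have two: "2 \<le> real n powr (c / 2)" .
      have "real n powr - b \<le> real n powr - c" using n1 c by (intro powr_mono) auto
      moreover have "1 / n \<le> real n powr - c"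
      proof -
        have "real n powr - 1 \<le> real n powr - c" using n1 c by (intro powr_mono) auto
        then show ?thesis using n by (simp add: powr_minus inverse_eq_divide)
      qed
      moreover have "2 * real n powr - c \<le> real n powr - (c / 2)"
      proof -
        have "2 * real n powr - c \<le> real n powr (c / 2) * real n powr - c"
          using two by (intro mult_right_mono) auto
        also have "\<dots> = real n powr - (c / 2)" by (simp flip: powr_add)
        finally show ?thesis .
      qed
      moreover have "a \<le> c / 2" unfolding a_def by (rule min.cobounded1)
      then have "real n powr - (c / 2) \<le> real n powr - a" using n1 by (intro powr_mono) auto
      ultimately show ?thesis using q(1) by linarith
    qed
  qed
qed

theorem theorem2:
  fixes p :: real
  assumes "0 < p" and "p \<le> 1"
  shows "\<exists>C>0.
    (\<exists>a>0. \<forall>n\<ge>2. \<forall>k\<ge>2. \<forall>adv T.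
       valid_adversary n adv \<and> real T \<ge> C * real (n + k) * ln (real n) * ln (real k) \<longrightarrow>
       measure_pmf.prob (sym_diff_run n k p adv T) {(S0, S). all_disseminated n S0 S}
         \<ge> 1 - real n powr (- a)) \<and>
    (\<forall>b>0. \<exists>a>0. \<forall>n\<ge>2. \<forall>k\<ge>2. \<forall>adv T.
       measure_pmf.prob (random_config n k p) {S0. tokens_present n k S0}
         \<ge> 1 - real n powr (- b) \<and>
       valid_adversary n adv \<and> real T \<ge> C * real (n + k) * ln (real n) * ln (real k) \<longrightarrow>
       measure_pmf.prob (sym_diff_run n k p adv T) {(S0, S). gossip_complete n k S}
         \<ge> 1 - real n powr (- a))"
proof (rule exI[of _ "60000 / p"], intro conjI allI impI)
  show "0 < 60000 / p" using assms by simp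
  show "\<exists>a>0. \<forall>n\<ge>2. \<forall>k\<ge>2. \<forall>adv T.
       valid_adversary n adv \<and> real T \<ge> 60000 / p * real (n + k) * ln (real n) * ln (real k) \<longrightarrow>
       measure_pmf.prob (sym_diff_run n k p adv T) {(S0, S). all_disseminated n S0 S}
         \<ge> 1 - real n powr (- a)"
  proof (intro exI[of _ 1] conjI allI impI, simp)
    fix n k adv T
    assume "2 \<le> n" "2 \<le> k" "valid_adversary n adv \<and> real T \<ge> 60000 / p * real (n + k) * ln (real n) * ln (real k)"
    then show "measure_pmf.prob (sym_diff_run n k p adv T) {(S0, S). all_disseminated n S0 S}
         \<ge> 1 - real n powr (- 1)"
      using prob_run_disseminated[of n k p adv T] assms by (simp add: powr_minus inverse_eq_divide)
  qed
  fix b :: real assume b: "0 < b"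
  obtain N where N: "\<And>eta. 0 < eta \<Longrightarrow> eta < 1 \<Longrightarrow>
    \<exists>a>0. \<forall>n\<ge>2. \<forall>q :: real. 1 - (real n powr - b + 1 / n) \<le> q \<longrightarrow> (real n \<le> N \<longrightarrow> eta \<le> q)
      \<longrightarrow> 1 - real n powr - a \<le> q"
    using powr_absorbs_small_cases[OF b] by metis
  \<comment> \<open>The success probability guaranteed for \<open>n \<le> N\<close>;
    \<open>1 - 2 powr - b\<close> bounds the probability of presence from below for every
    \<open>n \<ge> 2\<close>.\<close>
  define eta where "eta = min ((1 - 2 powr - b) / 2) (p ^ nat \<lceil>exp N\<rceil>)"
  have "0 < 2 powr - b" "2 powr - b < (1 :: real)" using b by (auto simp: powr_less_one)
  then have "0 < (1 - 2 powr - b) / 2" "(1 - 2 powr - b) / 2 < 1" by argo+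
  then have "0 < eta" "eta < 1" using assms unfolding eta_def by (auto simp: min_less_iff_disj)
  then obtain a where a: "0 < a" "\<And>n q. 2 \<le> n \<Longrightarrow> 1 - (real n powr - b + 1 / n) \<le> q \<Longrightarrow>
      (real n \<le> N \<Longrightarrow> eta \<le> q) \<Longrightarrow> 1 - real n powr - a \<le> q"
    using N by metis
  show "\<exists>a>0. \<forall>n\<ge>2. \<forall>k\<ge>2. \<forall>adv T.
       measure_pmf.prob (random_config n k p) {S0. tokens_present n k S0}
         \<ge> 1 - real n powr (- b) \<and>
       valid_adversary n adv \<and> real T \<ge> 60000 / p * real (n + k) * ln (real n) * ln (real k) \<longrightarrow>
       measure_pmf.prob (sym_diff_run n k p adv T) {(S0, S). gossip_complete n k S}
         \<ge> 1 - real n powr (- a)"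
  proof (intro exI[of _ a] conjI a(1) allI impI)
    fix n k adv T
    assume n: "2 \<le> n" and k: "2 \<le> k" and *: "1 - real n powr (- b)
        \<le> measure_pmf.prob (random_config n k p) {S0. tokens_present n k S0} \<and>
      valid_adversary n adv \<and> real T \<ge> 60000 / p * real (n + k) * ln (real n) * ln (real k)"
    then have present: "1 - real n powr (- b) \<le> measure_pmf.prob (random_config n k p) {S0. tokens_present n k S0}"
      and adv: "valid_adversary n adv" and T: "60000 / p * real (n + k) * ln (real n) * ln (real k) \<le> real T"
      by auto
    have "real n powr - b \<le> 2 powr - b" using n b by (intro powr_mono2') auto
    then have "1 - 2 powr - b \<le> measure_pmf.prob (random_config n k p) {S0. tokens_present n k S0}"
      using present by linarith
    then show "1 - real n powr (- a) \<le> measure_pmf.prob (sym_diff_run n k p adv T) {(S0, S). gossip_complete n k S}"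
      using prob_run_complete[OF n k assms adv T present] prob_run_complete_small[OF n k assms adv T]
      unfolding eta_def[symmetric] by (intro a(2) n) (auto simp: eta_def)
  qed
qed

end
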